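(* Let $T\in L(H)^n$ be a pure $m$-hypercontraction on a complex Hilbert space $H$, and let $C$, $\mathcal D$, $j$, $M$ and $W(M)$ be as in the context. A function $f\in H_m(\mathbb B,\mathcal D)$ belongs to $W(M)$ if and only if \[ f=f_0+M_z(M_z^*M_z)^{-1}(jx_i)_{i=1}^n \] for some vectors $f_0\in\mathcal D$ and $x_1,\dots,x_n\in H$ with $(jx_i)_{i=1}^n\in M_z^*H_m(\mathbb B,\mathcal D)$ and \[ Cf_0+T\Big(\sum_{j=0}^{m-1}(-1)^j\binom{m}{j+1}\sum_{|\alpha|=j}\gamma_\alpha T^\alpha T^{*\alpha}x_i\Big)_{i=1}^n=0 . \] In this case, $(jx_i)_{i=1}^n=M_z^*f$.
   Context: $\mathbb B=\{z\in\mathbb C^n:\|z\|<1\}$. For $\alpha\in\mathbb N^n$: $|\alpha|=\sum\alpha_i$, $\alpha!=\prod\alpha_i!$, $\gamma_\alpha=|\alpha|!/\alpha!$, $\rho_m(\alpha)=\frac{(m+|\alpha|-1)!}{\alpha!(m-1)!}$. $H_m(\mathbb B,\mathcal D)$ is the Hilbert space of analytic $f=\sum f_\alpha z^\alpha:\mathbb B\to\mathcal D$ with $\|f\|^2=\sum\|f_\alpha\|^2/\rho_m(\alpha)<\infty$ (kernel $(1-\langle z,w\rangle)^{-m}1_{\mathcal D}$); constants in $\mathcal D$ are regarded as constant functions. $M_z=(M_{z_1},\dots,M_{z_n})$ is the multiplication tuple, also viewed as the row operator $H_m(\mathbb B,\mathcal D)^n\to H_m(\mathbb B,\mathcal D)$,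 $(f_i)\mapsto\sum z_if_i$, with column adjoint $M_z^*f=(M_{z_i}^*f)_i$; since $M_z$ has closed range, $M_z^*M_z=(M_{z_i}^*M_{z_j})_{i,j}$ is invertible on the closed subspace $\operatorname{Im}M_z^*$, and $(M_z^*M_z)^{-1}$ denotes that inverse. For a commuting tuple $T=(T_1,\dots,T_n)\in L(H)^n$: $\sigma_T(X)=\sum_iT_iXT_i^*$, $\Delta_T^{(k)}=(1-\sigma_T)^k(1_H)$; $T$ is an $m$-hypercontraction if $\Delta_T^{(1)}\ge0$ and $\Delta_T^{(m)}\ge0$, and pure if $\sigma_T^k(1_H)\to0$ in the strong operator topology. $T$ is also regarded as the row operator $H^n\to H$, $(h_i)\mapsto\sum T_ih_i$; $T^*$ is the column operator $h\mapsto(T_i^*h)_i$; for $z\in\mathbb B$, $Z:H^n\to H$, $(h_i)\mapsto\sum z_ih_i$; $T^\alpha=T_1^{\alpha_1}\cdots T_n^{\alpha_n}$, $T^{*\alpha}=(T^\alpha)^*$. Set $C=(\Delta_T^{(m)})^{1/2}$, $\mathcal D=\overline{CH}$, and $j:H\to H_m(\mathbb B,\mathcal D)$, $jx=\sum_\alpha\rho_m(\alpha)(CT^{*\alpha}x)z^\alpha=C(1_H-ZT^* )^{-m}x$; for pure $m$-hypercontractions $j$ is an isometry with $jT_i^*=M_{z_i}^*j$. Let $M=H_m(\mathbb B,\mathcal D)\ominus\operatorname{Im}j$ (an $M_z$-invariant subspace) and $W(M)=M\ominus\overline{\sum_{i=1}^nz_iM}$. *)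

theory Defs
  imports "HOL-Analysis.Analysis"
begin

section \<open>Complex Hilbert spaces\<close>

text \<open>The distribution has no complex inner product spaces; we introduce them as a type class.
  The inner product is conjugate-linear in the first and linear in the second argument.\<close>

class complex_hilbert = banach +
  fixes scaleC :: "complex \<Rightarrow> 'a \<Rightarrow> 'a"
    and cinner :: "'a \<Rightarrow> 'a \<Rightarrow> complex"
  assumes scaleC_add_right: "scaleC a (x + y) = scaleC a x + scaleC a y"
    and scaleC_add_left: "scaleC (a + b) x = scaleC a x + scaleC b x"
    and scaleC_scaleC: "scaleC a (scaleC b x) = scaleC (a * b) x"
    and scaleC_of_real: "scaleC (of_real r) x = scaleR r x"
    and cinner_commute: "cinner x y = cnj (cinner y x)"
    and cinner_add_left: "cinner (x + y) z = cinner x z + cinner y z"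
    and cinner_scaleC_left: "cinner (scaleC a x) y = cnj a * cinner x y"
    and cinner_self_norm: "cinner x x = complex_of_real ((norm x)\<^sup>2)"

section \<open>Operators on H\<close>

definition bounded_clinear_op :: "('a::complex_hilbert \<Rightarrow> 'a) \<Rightarrow> bool" where
  "bounded_clinear_op A \<longleftrightarrow>
     (\<forall>x y. A (x + y) = A x + A y) \<and> (\<forall>c x. A (scaleC c x) = scaleC c (A x)) \<and>
     (\<exists>K. \<forall>x. norm (A x) \<le> K * norm x)"

text \<open>Hilbert space adjoint.\<close>
definition adjH :: "('a::complex_hilbert \<Rightarrow> 'a) \<Rightarrow> 'a \<Rightarrow> 'a" where
  "adjH A = (\<lambda>y. THE z. \<forall>x. cinner (A x) y = cinner x z)"

text \<open>Positive operator \<open>A \<ge> 0\<close>.\<close>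
definition pos_op :: "('a::complex_hilbert \<Rightarrow> 'a) \<Rightarrow> bool" where
  "pos_op A \<longleftrightarrow> (\<forall>x. Im (cinner x (A x)) = 0 \<and> Re (cinner x (A x)) \<ge> 0)"

text \<open>Positive square root of a positive operator.\<close>
definition op_sqrt :: "('a::complex_hilbert \<Rightarrow> 'a) \<Rightarrow> 'a \<Rightarrow> 'a" where
  "op_sqrt A = (THE B. bounded_clinear_op B \<and> pos_op B \<and> B \<circ> B = A)"

text \<open>A tuple \<open>T = (T 0, ..., T (n-1))\<close>.\<close>
definition sigmaT :: "nat \<Rightarrow> (nat \<Rightarrow> 'a::complex_hilbert \<Rightarrow> 'a) \<Rightarrow> ('a \<Rightarrow> 'a) \<Rightarrow> 'a \<Rightarrow> 'a" where
  "sigmaT n T X = (\<lambda>h. \<Sum>i<n. T i (X (adjH (T i) h)))"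

definition DeltaT :: "nat \<Rightarrow> (nat \<Rightarrow> 'a::complex_hilbert \<Rightarrow> 'a) \<Rightarrow> nat \<Rightarrow> 'a \<Rightarrow> 'a" where
  "DeltaT n T k = ((\<lambda>X. (\<lambda>h. X h - sigmaT n T X h)) ^^ k) id"

definition commuting_tuple :: "nat \<Rightarrow> (nat \<Rightarrow> 'a::complex_hilbert \<Rightarrow> 'a) \<Rightarrow> bool" where
  "commuting_tuple n T \<longleftrightarrow> (\<forall>i<n. bounded_clinear_op (T i)) \<and>
     (\<forall>i<n. \<forall>k<n. T i \<circ> T k = T k \<circ> T i)"

definition m_hypercontraction :: "nat \<Rightarrow> nat \<Rightarrow> (nat \<Rightarrow> 'a::complex_hilbert \<Rightarrow> 'a) \<Rightarrow> bool" where
  "m_hypercontraction n m T \<longleftrightarrow> pos_op (DeltaT n T 1) \<and> pos_op (DeltaT n T m)"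

definition pure_tuple :: "nat \<Rightarrow> (nat \<Rightarrow> 'a::complex_hilbert \<Rightarrow> 'a) \<Rightarrow> bool" where
  "pure_tuple n T \<longleftrightarrow> (\<forall>h. (\<lambda>k. ((sigmaT n T ^^ k) id) h) \<longlonglongrightarrow> 0)"

section \<open>Multi-indices\<close>

text \<open>Multi-indices in \<open>\<nat>^n\<close> are functions \<open>nat \<Rightarrow> nat\<close> vanishing from \<open>n\<close> on.\<close>
definition mindex :: "nat \<Rightarrow> (nat \<Rightarrow> nat) set" where
  "mindex n = {\<alpha>. \<forall>i\<ge>n. \<alpha> i = 0}"

definition mabs :: "nat \<Rightarrow> (nat \<Rightarrow> nat) \<Rightarrow> nat" where
  "mabs n \<alpha> = (\<Sum>i<n. \<alpha> i)"

definition mfact :: "nat \<Rightarrow> (nat \<Rightarrow> nat) \<Rightarrow> nat" where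
  "mfact n \<alpha> = (\<Prod>i<n. fact (\<alpha> i))"

definition gammaM :: "nat \<Rightarrow> (nat \<Rightarrow> nat) \<Rightarrow> real" where
  "gammaM n \<alpha> = fact (mabs n \<alpha>) / real (mfact n \<alpha>)"

definition rhoM :: "nat \<Rightarrow> nat \<Rightarrow> (nat \<Rightarrow> nat) \<Rightarrow> real" where
  "rhoM n m \<alpha> = fact (m + mabs n \<alpha> - 1) / (real (mfact n \<alpha>) * fact (m - 1))"

text \<open>\<open>T^\<alpha> = T_1^{\<alpha>_1} \<cdots> T_n^{\<alpha>_n}\<close>.\<close>
definition Tpow :: "nat \<Rightarrow> (nat \<Rightarrow> 'a \<Rightarrow> 'a) \<Rightarrow> (nat \<Rightarrow> nat) \<Rightarrow> 'a \<Rightarrow> 'a" where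
  "Tpow n T \<alpha> = foldr (\<lambda>i acc. (T i ^^ \<alpha> i) \<circ> acc) [0..<n] id"

section \<open>The space \<open>H_m(\<bool>, \<D>)\<close>\<close>

text \<open>An analytic function \<open>f = \<Sum> f_\<alpha> z^\<alpha>\<close> is represented by its Taylor coefficient family
  \<open>\<alpha> \<mapsto> f_\<alpha>\<close> (zero outside \<open>\<nat>^n\<close>).\<close>
definition Hm :: "nat \<Rightarrow> nat \<Rightarrow> 'a::complex_hilbert set \<Rightarrow> ((nat \<Rightarrow> nat) \<Rightarrow> 'a) set" where
  "Hm n m D = {f. (\<forall>\<alpha>. \<alpha> \<notin> mindex n \<longrightarrow> f \<alpha> = 0) \<and> (\<forall>\<alpha>. f \<alpha> \<in> D) \<and>
      (\<lambda>\<alpha>. (norm (f \<alpha>))\<^sup>2 / rhoM n m \<alpha>) summable_on mindex n}"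

definition hm_inner :: "nat \<Rightarrow> nat \<Rightarrow> ((nat \<Rightarrow> nat) \<Rightarrow> 'a::complex_hilbert) \<Rightarrow> ((nat \<Rightarrow> nat) \<Rightarrow> 'a) \<Rightarrow> complex" where
  "hm_inner n m f g = (\<Sum>\<^sub>\<infinity>\<alpha>\<in>mindex n. cinner (f \<alpha>) (g \<alpha>) / complex_of_real (rhoM n m \<alpha>))"

definition hm_norm :: "nat \<Rightarrow> nat \<Rightarrow> ((nat \<Rightarrow> nat) \<Rightarrow> 'a::complex_hilbert) \<Rightarrow> real" where
  "hm_norm n m f = sqrt (Re (hm_inner n m f f))"

text \<open>Constants in \<open>\<D>\<close> as constant functions.\<close>
definition const_fn :: "'a::zero \<Rightarrow> (nat \<Rightarrow> nat) \<Rightarrow> 'a" where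
  "const_fn c = (\<lambda>\<alpha>. if \<alpha> = (\<lambda>_. 0) then c else 0)"

text \<open>Multiplication by \<open>z_i\<close> on coefficient families.\<close>
definition Mz :: "nat \<Rightarrow> nat \<Rightarrow> ((nat \<Rightarrow> nat) \<Rightarrow> 'a::zero) \<Rightarrow> (nat \<Rightarrow> nat) \<Rightarrow> 'a" where
  "Mz n i f = (\<lambda>\<alpha>. if \<alpha> \<in> mindex n \<and> 1 \<le> \<alpha> i then f (\<alpha>(i := \<alpha> i - 1)) else 0)"

text \<open>Adjoint of an operator on a (sub)space \<open>S\<close> with inner product \<open>ip\<close>.\<close>
definition adj_on :: "'f set \<Rightarrow> ('f \<Rightarrow> 'f \<Rightarrow> complex) \<Rightarrow> ('f \<Rightarrow> 'f) \<Rightarrow> 'f \<Rightarrow> 'f" where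
  "adj_on S ip A = (\<lambda>g. THE h. h \<in> S \<and> (\<forall>f\<in>S. ip (A f) g = ip f h))"

text \<open>Row operator \<open>M_z : H_m^n \<rightarrow> H_m\<close>, \<open>(f_i) \<mapsto> \<Sum> z_i f_i\<close>.\<close>
definition Mz_row :: "nat \<Rightarrow> (nat \<Rightarrow> (nat \<Rightarrow> nat) \<Rightarrow> 'a::comm_monoid_add) \<Rightarrow> (nat \<Rightarrow> nat) \<Rightarrow> 'a" where
  "Mz_row n F = (\<lambda>\<alpha>. \<Sum>i<n. Mz n i (F i) \<alpha>)"

text \<open>Column adjoint \<open>M_z^* f = (M_{z_i}^* f)_i\<close>; tuples are indexed by \<open>i < n\<close> and are 0 elsewhere.\<close>
definition Mz_star :: "nat \<Rightarrow> nat \<Rightarrow> 'a::complex_hilbert set \<Rightarrow> ((nat \<Rightarrow> nat) \<Rightarrow> 'a) \<Rightarrow> nat \<Rightarrow> (nat \<Rightarrow> nat) \<Rightarrow> 'a" where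
  "Mz_star n m D f = (\<lambda>i. if i < n then adj_on (Hm n m D) (hm_inner n m) (Mz n i) f else (\<lambda>_. 0))"

text \<open>\<open>(M_z^* M_z)^{-1}\<close>: inverse of \<open>M_z^* M_z\<close> restricted to \<open>Im M_z^*\<close>.\<close>
definition gram_inv :: "nat \<Rightarrow> nat \<Rightarrow> 'a::complex_hilbert set \<Rightarrow> (nat \<Rightarrow> (nat \<Rightarrow> nat) \<Rightarrow> 'a) \<Rightarrow> nat \<Rightarrow> (nat \<Rightarrow> nat) \<Rightarrow> 'a" where
  "gram_inv n m D y = (THE u. u \<in> Mz_star n m D ` Hm n m D \<and> Mz_star n m D (Mz_row n u) = y)"

text \<open>Orthogonal difference \<open>A \<ominus> B\<close> and norm closure inside \<open>H_m\<close>.\<close>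
definition hm_ominus :: "nat \<Rightarrow> nat \<Rightarrow> ((nat \<Rightarrow> nat) \<Rightarrow> 'a::complex_hilbert) set \<Rightarrow> ((nat \<Rightarrow> nat) \<Rightarrow> 'a) set \<Rightarrow> ((nat \<Rightarrow> nat) \<Rightarrow> 'a) set" where
  "hm_ominus n m A B = {f \<in> A. \<forall>g\<in>B. hm_inner n m f g = 0}"

definition hm_closure :: "nat \<Rightarrow> nat \<Rightarrow> 'a::complex_hilbert set \<Rightarrow> ((nat \<Rightarrow> nat) \<Rightarrow> 'a) set \<Rightarrow> ((nat \<Rightarrow> nat) \<Rightarrow> 'a) set" where
  "hm_closure n m D S = {f \<in> Hm n m D. \<forall>e>0. \<exists>g\<in>S. hm_norm n m (\<lambda>\<alpha>. f \<alpha> - g \<alpha>) < e}"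

section \<open>The objects \<open>C\<close>, \<open>\<D>\<close>, \<open>j\<close>, \<open>M\<close>, \<open>W(M)\<close>\<close>

definition defectC :: "nat \<Rightarrow> nat \<Rightarrow> (nat \<Rightarrow> 'a::complex_hilbert \<Rightarrow> 'a) \<Rightarrow> 'a \<Rightarrow> 'a" where
  "defectC n m T = op_sqrt (DeltaT n T m)"

definition defectD :: "nat \<Rightarrow> nat \<Rightarrow> (nat \<Rightarrow> 'a::complex_hilbert \<Rightarrow> 'a) \<Rightarrow> 'a set" where
  "defectD n m T = closure (range (defectC n m T))"

text \<open>\<open>j x = \<Sum>_\<alpha> \<rho>_m(\<alpha>) (C T^{*\<alpha>} x) z^\<alpha>\<close>.\<close>
definition jmap :: "nat \<Rightarrow> nat \<Rightarrow> (nat \<Rightarrow> 'a::complex_hilbert \<Rightarrow> 'a) \<Rightarrow> 'a \<Rightarrow> (nat \<Rightarrow> nat) \<Rightarrow> 'a" where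
  "jmap n m T x = (\<lambda>\<alpha>. if \<alpha> \<in> mindex n
      then rhoM n m \<alpha> *\<^sub>R defectC n m T (adjH (Tpow n T \<alpha>) x) else 0)"

definition Msub :: "nat \<Rightarrow> nat \<Rightarrow> (nat \<Rightarrow> 'a::complex_hilbert \<Rightarrow> 'a) \<Rightarrow> ((nat \<Rightarrow> nat) \<Rightarrow> 'a) set" where
  "Msub n m T = hm_ominus n m (Hm n m (defectD n m T)) (range (jmap n m T))"

definition WM :: "nat \<Rightarrow> nat \<Rightarrow> (nat \<Rightarrow> 'a::complex_hilbert \<Rightarrow> 'a) \<Rightarrow> ((nat \<Rightarrow> nat) \<Rightarrow> 'a) set" where
  "WM n m T = hm_ominus n m (Msub n m T)
     (hm_closure n m (defectD n m T) {Mz_row n g | g. \<forall>i<n. g i \<in> Msub n m T})"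

end

theory Submission
  imports Defs
begin

text \<open>
  In Taylor coefficients \<open>M\<^sub>z M\<^sub>z\<^sup>*\<close> is diagonal, and \<open>M\<^sub>z (M\<^sub>z\<^sup>* M\<^sub>z)\<inverse> M\<^sub>z\<^sup>*\<close> removes the constant
  term. The representation of \<open>f\<close> therefore says \<open>f\<^sub>0 = f(0)\<close> and \<open>M\<^sub>z\<^sup>* f = (j x\<^sub>i)\<^sub>i\<close>. The latter
  means that every \<open>M\<^bsub>z\<^sub>i\<^esub>\<^sup>* f\<close> is orthogonal to \<open>M\<close>, as \<open>M\<^sup>\<bottom> = Im j\<close>. What remains of membership in
  \<open>W(M)\<close> is \<open>j\<^sup>* f = 0\<close>, and \<open>j\<^sup>* f = C f\<^sub>0 + T (\<Sum>\<^bsub>k<m\<^esub> \<Delta>\<^sup>(\<^sup>k\<^sup>) x\<^sub>i)\<^sub>i\<close> follows by comparing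
  coefficients.

  Purity makes \<open>\<langle>\<sigma>\<^sup>i(\<Delta>\<^sup>(\<^sup>k\<^sup>)) x, x\<rangle>\<close> tend to \<open>0\<close>, so telescoping \<open>\<Delta>\<^sup>(\<^sup>k\<^sup>+\<^sup>1\<^sup>) = \<Delta>\<^sup>(\<^sup>k\<^sup>) - \<sigma>(\<Delta>\<^sup>(\<^sup>k\<^sup>))\<close>
  expands \<open>\<Delta>\<^sup>(\<^sup>m\<^sup>-\<^sup>d\<^sup>)\<close> weakly as \<open>\<Sum>\<^sub>k (d+k-1 choose k) \<sigma>\<^sup>k(\<Delta>\<^sup>(\<^sup>m\<^sup>))\<close>. The case \<open>d = m\<close> is the
  isometry of \<open>j\<close>; the sum over \<open>d = 1, \<dots>, m\<close> gives \<open>\<Sum>\<^bsub>k<m\<^esub> \<Delta>\<^sup>(\<^sup>k\<^sup>)\<close>.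
\<close>

section \<open>Complex Hilbert spaces\<close>

lemma scaleC_minus1: "scaleC (-1) (x::'a::complex_hilbert) = - x"
  using scaleC_of_real[of "-1" x] by simp

lemma cinner_add_right: "cinner x (y + z) = cinner x y + cinner (x::'a::complex_hilbert) z"
  by (metis cinner_add_left cinner_commute complex_cnj_add)

lemma cinner_scaleC_right: "cinner x (scaleC a y) = a * cinner (x::'a::complex_hilbert) y"
  by (metis cinner_scaleC_left cinner_commute complex_cnj_mult complex_cnj_cnj)

lemma cinner_zero_left [simp]: "cinner 0 (y::'a::complex_hilbert) = 0"
  using cinner_add_left[of 0 0 y] by simp

lemma cinner_zero_right [simp]: "cinner (y::'a::complex_hilbert) 0 = 0"
  using cinner_add_right[of y 0 0] by simp

lemma cinner_minus_left [simp]: "cinner (- x) (y::'a::complex_hilbert) = - cinner x y"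
  using cinner_scaleC_left[of "-1" x y] by (simp add: scaleC_minus1)

lemma cinner_minus_right [simp]: "cinner x (- y::'a::complex_hilbert) = - cinner x y"
  using cinner_scaleC_right[of x "-1" y] by (simp add: scaleC_minus1)

lemma cinner_diff_left: "cinner (x - y) (z::'a::complex_hilbert) = cinner x z - cinner y z"
  using cinner_add_left[of x "- y" z] by simp

lemma cinner_diff_right: "cinner z (x - y::'a::complex_hilbert) = cinner z x - cinner z y"
  using cinner_add_right[of z x "- y"] by simp

lemma cinner_scaleR_left: "cinner (r *\<^sub>R x) (y::'a::complex_hilbert) = of_real r * cinner x y"
  using cinner_scaleC_left[of "of_real r" x y] by (simp add: scaleC_of_real)

lemma cinner_scaleR_right: "cinner x (r *\<^sub>R y::'a::complex_hilbert) = of_real r * cinner x y"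
  using cinner_scaleC_right[of x "of_real r" y] by (simp add: scaleC_of_real)

lemma cinner_sum_left: "cinner (sum f A) (y::'a::complex_hilbert) = (\<Sum>i\<in>A. cinner (f i) y)"
  by (induction A rule: infinite_finite_induct) (auto simp: cinner_add_left)

lemma cinner_sum_right: "cinner (y::'a::complex_hilbert) (sum f A) = (\<Sum>i\<in>A. cinner y (f i))"
  by (induction A rule: infinite_finite_induct) (auto simp: cinner_add_right)

lemma scaleC_zero_right [simp]: "scaleC a (0::'a::complex_hilbert) = 0"
  using scaleC_add_right[of a 0 0] by simp

lemma scaleC_scaleR: "scaleC a (r *\<^sub>R x::'a::complex_hilbert) = r *\<^sub>R scaleC a x"
  by (simp add: scaleC_of_real[symmetric] scaleC_scaleC mult.commute)

lemma norm_square_Re_cinner: "(norm (x::'a::complex_hilbert))\<^sup>2 = Re (cinner x x)"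
  by (simp add: cinner_self_norm)

lemma norm_scaleC: "norm (scaleC a (x::'a::complex_hilbert)) = cmod a * norm x"
proof -
  have "complex_of_real ((norm (scaleC a x))\<^sup>2) = complex_of_real ((cmod a * norm x)\<^sup>2)"
    unfolding cinner_self_norm[symmetric] of_real_mult power_mult_distrib complex_norm_square
    by (simp add: cinner_scaleC_left cinner_scaleC_right)
  then have "(norm (scaleC a x))\<^sup>2 = (cmod a * norm x)\<^sup>2"
    using of_real_eq_iff by blast
  then show ?thesis by (simp add: power2_eq_iff_nonneg)
qed

lemma Re_cinner_commute: "Re (cinner x y) = Re (cinner y (x::'a::complex_hilbert))"
  by (subst cinner_commute) simp

lemma norm_diff_square:
  "(norm (x - y::'a::complex_hilbert))\<^sup>2 = (norm x)\<^sup>2 - 2 * Re (cinner x y) + (norm y)\<^sup>2"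
  unfolding norm_square_Re_cinner
  by (simp add: cinner_diff_left cinner_diff_right Re_cinner_commute[of y x])

lemma norm_add_square:
  "(norm (x + y::'a::complex_hilbert))\<^sup>2 = (norm x)\<^sup>2 + 2 * Re (cinner x y) + (norm y)\<^sup>2"
  unfolding norm_square_Re_cinner
  by (simp add: cinner_add_left cinner_add_right Re_cinner_commute[of y x])

lemma Re_cinner_le: "Re (cinner x y) \<le> norm x * norm (y::'a::complex_hilbert)"
proof -
  have "(norm (x + y))\<^sup>2 \<le> (norm x + norm y)\<^sup>2"
    by (intro power_mono norm_triangle_ineq) auto
  then show ?thesis by (simp add: norm_add_square power2_sum)
qed

lemma cmod_cinner_le: "cmod (cinner x y) \<le> norm x * norm (y::'a::complex_hilbert)"
proof (cases "cinner x y = 0")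
  case False
  define c where "c = cnj (sgn (cinner x y))"
  have c: "cmod c = 1" using False by (simp add: c_def norm_sgn)
  have "cinner x y = sgn (cinner x y) * of_real (cmod (cinner x y))"
    using False by (simp add: sgn_eq)
  then have "c * cinner x y = (c * sgn (cinner x y)) * of_real (cmod (cinner x y))"
    by (metis mult.assoc)
  also have "c * sgn (cinner x y) = of_real ((cmod c)\<^sup>2)"
    unfolding complex_norm_square by (simp add: c_def)
  finally have "c * cinner x y = of_real (cmod (cinner x y))" by (simp add: c)
  then have "cmod (cinner x y) = Re (cinner x (scaleC c y))"
    by (simp add: cinner_scaleC_right)
  also have "\<dots> \<le> norm x * norm y"
    using Re_cinner_le[of x "scaleC c y"] c by (simp add: norm_scaleC)
  finally show ?thesis .
qed simp

lemma cmod_cinner_le_half: "2 * cmod (cinner x y) \<le> (norm x)\<^sup>2 + (norm (y::'a::complex_hilbert))\<^sup>2"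
  using cmod_cinner_le[of x y] sum_squares_bound[of "norm x" "norm y"] by linarith

lemma bounded_linear_cinner_right: "bounded_linear (cinner (x::'a::complex_hilbert))"
  by (rule bounded_linear_intro[of _ "norm x"])
    (use cmod_cinner_le[of x] in \<open>auto simp: cinner_add_right cinner_scaleR_right scaleR_conv_of_real mult.commute\<close>)

lemma cinner_right_eqI:
  assumes "\<And>x. cinner x y = cinner x (z::'a::complex_hilbert)"
  shows "y = z"
proof -
  have "cinner (y - z) (y - z) = 0" by (simp add: cinner_diff_right assms)
  then show ?thesis by (simp add: cinner_self_norm)
qed

lemma cinner_left_eqI:
  assumes "\<And>x. cinner y x = cinner z (x::'a::complex_hilbert)"
  shows "y = z"
  by (rule cinner_right_eqI) (metis assms cinner_commute)

text \<open>The representing vector minimises \<open>\<parallel>x\<parallel>\<^sup>2 - 2 Re (\<phi> x)\<close>; the parallelogram law makes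
  minimising sequences Cauchy.\<close>

lemma riesz_representation:
  fixes \<phi> :: "'a::complex_hilbert \<Rightarrow> complex"
  assumes add: "\<And>x y. \<phi> (x + y) = \<phi> x + \<phi> y" and scale: "\<And>c x. \<phi> (scaleC c x) = c * \<phi> x"
    and bd: "\<And>x. cmod (\<phi> x) \<le> K * norm x"
  shows "\<exists>v. \<forall>x. \<phi> x = cinner v x"
proof -
  have scaleR: "\<phi> (r *\<^sub>R x) = r * \<phi> x" for r x
    using scale[of "of_real r" x] by (simp add: scaleC_of_real)
  have blin: "bounded_linear \<phi>"
    by (rule bounded_linear_intro[of _ K])
      (use bd in \<open>auto simp: add scaleR scaleR_conv_of_real mult.commute\<close>)
  define J where "J x = (norm x)\<^sup>2 - 2 * Re (\<phi> x)" for x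
  have lower: "J x \<ge> - K\<^sup>2" for x
  proof -
    have "Re (\<phi> x) \<le> K * norm x" using bd[of x] complex_Re_le_cmod[of "\<phi> x"] by linarith
    moreover have "0 \<le> (norm x - K)\<^sup>2" by simp
    ultimately show ?thesis unfolding J_def power2_diff by (simp add: mult.commute)
  qed
  define I where "I = (INF x. J x)"
  have bdd: "bdd_below (range J)" using lower by (intro bdd_belowI2) auto
  have I_le: "I \<le> J x" for x unfolding I_def by (rule cINF_lower[OF bdd]) simp
  have "\<exists>x. J x < I + 1 / real (Suc k)" for k
  proof -
    have "Inf (range J) < I + 1 / real (Suc k)" unfolding I_def by simp
    then show ?thesis using cInf_lessD[of "range J"] by auto
  qed
  then obtain X where X: "\<And>k. J (X k) < I + 1 / real (Suc k)" by metis
  have para: "(norm (a - b))\<^sup>2 \<le> 2 * (J a - I) + 2 * (J b - I)" for a b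
  proof -
    define c where "c = (1/2) *\<^sub>R (a + b)"
    have "J a + J b - 2 * J c = (norm (a - b))\<^sup>2 / 2"
      unfolding J_def c_def norm_scaleR power_mult_distrib norm_add_square norm_diff_square
      by (simp add: add scaleR power2_eq_square field_simps)
    with I_le[of c] show ?thesis by argo
  qed
  have "Cauchy X"
  proof (rule metric_CauchyI)
    fix e :: real assume e: "e > 0"
    obtain N where N: "1 / real (Suc N) < e\<^sup>2 / 4"
      using nat_approx_posE[of "e\<^sup>2 / 4"] e by auto
    have "dist (X k) (X l) < e" if "k \<ge> N" "l \<ge> N" for k l
    proof -
      have "1 / real (Suc k) \<le> 1 / real (Suc N)" "1 / real (Suc l) \<le> 1 / real (Suc N)"
        using that by (auto simp: frac_le)
      then have "(norm (X k - X l))\<^sup>2 < e\<^sup>2"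
        using para[of "X k" "X l"] X[of k] X[of l] N by argo
      then show ?thesis using e by (simp add: dist_norm power2_less_imp_less)
    qed
    then show "\<exists>M. \<forall>k\<ge>M. \<forall>l\<ge>M. dist (X k) (X l) < e" by blast
  qed
  then obtain v where v: "X \<longlonglongrightarrow> v" using Cauchy_convergent convergent_def by blast
  have "(\<lambda>k. J (X k)) \<longlonglongrightarrow> J v"
    unfolding J_def by (intro tendsto_intros v bounded_linear.tendsto[OF blin])
  moreover have "(\<lambda>k. I + 1 / real (Suc k)) \<longlonglongrightarrow> I + 0"
    by (intro tendsto_intros LIMSEQ_Suc[OF lim_1_over_n])
  ultimately have "J v \<le> I"
    using LIMSEQ_le[of "\<lambda>k. J (X k)" "J v" "\<lambda>k. I + 1 / real (Suc k)" "I + 0"] X less_imp_le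
    by (metis add.right_neutral)
  then have min: "J v \<le> J x" for x using I_le[of x] by linarith
  have re: "Re (\<phi> h) \<le> Re (cinner v h)" for h
  proof (rule ccontr)
    assume neg: "\<not> Re (\<phi> h) \<le> Re (cinner v h)"
    define d where "d = Re (\<phi> h) - Re (cinner v h)"
    have d: "d > 0" using neg by (simp add: d_def)
    have q: "J (v + t *\<^sub>R h) = J v + t\<^sup>2 * (norm h)\<^sup>2 - 2 * t * d" for t
      unfolding J_def norm_add_square d_def
      by (simp add: add scaleR cinner_scaleR_right power_mult_distrib algebra_simps)
    then have *: "2 * t * d \<le> t\<^sup>2 * (norm h)\<^sup>2" for t using min[of "v + t *\<^sub>R h"] by simp
    define t where "t = d / ((norm h)\<^sup>2 + 1)"
    have t: "t > 0" using d by (simp add: t_def add_nonneg_pos)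
    have "2 * d \<le> t * (norm h)\<^sup>2" using *[of t] t by (simp add: power2_eq_square)
    also have "\<dots> \<le> t * ((norm h)\<^sup>2 + 1)" using t by simp
    also have "\<dots> = d" by (simp add: t_def add_nonneg_eq_0_iff)
    finally show False using d by simp
  qed
  have re_eq: "Re (\<phi> h) = Re (cinner v h)" for h
    using re[of h] re[of "- h"] scaleR[of "-1" h] by simp
  have "\<phi> h = cinner v h" for h
  proof (rule complex_eqI)
    show "Re (\<phi> h) = Re (cinner v h)" by (rule re_eq)
    show "Im (\<phi> h) = Im (cinner v h)"
      using re_eq[of "scaleC \<i> h"] by (simp add: scale cinner_scaleC_right)
  qed
  then show ?thesis by blast
qed

section \<open>Bounded operators and adjoints\<close>

lemma bounded_clinear_opD:
  assumes "bounded_clinear_op A"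
  shows "A (x + y) = A x + A y" "A (scaleC c x) = scaleC c (A x)"
    "A 0 = 0" "A (- x) = - A x" "A (x - y) = A x - A y" "A (r *\<^sub>R x) = r *\<^sub>R A x"
    "A (sum f S) = (\<Sum>i\<in>S. A (f i))"
proof -
  show add: "A (x + y) = A x + A y" for x y using assms unfolding bounded_clinear_op_def by blast
  show scale: "A (scaleC c x) = scaleC c (A x)" for c x
    using assms unfolding bounded_clinear_op_def by blast
  show zero: "A 0 = 0" using add[of 0 0] by simp
  show minus: "A (- x) = - A x" for x using add[of x "- x"] zero by (simp add: eq_neg_iff_add_eq_0 add.commute)
  show "A (x - y) = A x - A y" using add[of x "- y"] minus by simp
  show "A (r *\<^sub>R x) = r *\<^sub>R A x" using scale[of "of_real r" x] by (simp add: scaleC_of_real)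
  show "A (sum f S) = (\<Sum>i\<in>S. A (f i))"
    by (induction S rule: infinite_finite_induct) (auto simp: add zero)
qed

lemma bounded_clinear_op_bound:
  assumes "bounded_clinear_op A"
  obtains K where "K > 0" "\<And>x. norm (A x) \<le> K * norm x"
proof -
  obtain K where K: "\<And>x. norm (A x) \<le> K * norm x"
    using assms unfolding bounded_clinear_op_def by blast
  have "norm (A x) \<le> (\<bar>K\<bar> + 1) * norm x" for x
    by (rule order_trans[OF K]) (intro mult_right_mono, auto)
  then show ?thesis using that[of "\<bar>K\<bar> + 1"] by auto
qed

lemma bounded_clinear_opI:
  assumes "\<And>x y. A (x + y) = A x + A y" "\<And>c x. A (scaleC c x) = scaleC c (A x)"
    "\<And>x. norm (A x) \<le> K * norm x"
  shows "bounded_clinear_op A"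
  using assms unfolding bounded_clinear_op_def by blast

lemma bounded_clinear_op_bounded_linear:
  assumes "bounded_clinear_op A" shows "bounded_linear A"
proof -
  obtain K where "\<And>x. norm (A x) \<le> K * norm x" using assms bounded_clinear_op_bound by metis
  then show ?thesis
    by (intro bounded_linear_intro[of _ K]) (auto simp: bounded_clinear_opD[OF assms] mult.commute)
qed

lemma bounded_clinear_op_id: "bounded_clinear_op (\<lambda>x. x)" "bounded_clinear_op id"
  by (auto intro!: bounded_clinear_opI[where K=1])

lemma bounded_clinear_op_zero: "bounded_clinear_op (\<lambda>x. 0)"
  by (auto intro!: bounded_clinear_opI[where K=0])

lemma bounded_clinear_op_add:
  assumes "bounded_clinear_op A" "bounded_clinear_op B"
  shows "bounded_clinear_op (\<lambda>x. A x + B x)"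
proof -
  obtain K L where "\<And>x. norm (A x) \<le> K * norm x" "\<And>x. norm (B x) \<le> L * norm x"
    using assms bounded_clinear_op_bound by metis
  then show ?thesis
    by (intro bounded_clinear_opI[where K="K + L"])
      (auto simp: bounded_clinear_opD[OF assms(1)] bounded_clinear_opD[OF assms(2)]
        scaleC_add_right distrib_right intro: norm_triangle_le add_mono)
qed

lemma bounded_clinear_op_scaleR:
  assumes "bounded_clinear_op A"
  shows "bounded_clinear_op (\<lambda>x. r *\<^sub>R A x)"
proof -
  obtain K where "\<And>x. norm (A x) \<le> K * norm x"
    using assms bounded_clinear_op_bound by metis
  then show ?thesis
    by (intro bounded_clinear_opI[where K="\<bar>r\<bar> * K"])
      (auto simp: bounded_clinear_opD[OF assms] scaleC_scaleR scaleR_add_right mult.assoc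
        intro: mult_left_mono)
qed

lemma bounded_clinear_op_diff:
  assumes "bounded_clinear_op A" "bounded_clinear_op B"
  shows "bounded_clinear_op (\<lambda>x. A x - B x)"
  using bounded_clinear_op_add[OF assms(1) bounded_clinear_op_scaleR[OF assms(2), of "-1"]] by simp

lemma bounded_clinear_op_compose:
  assumes "bounded_clinear_op A" "bounded_clinear_op B"
  shows "bounded_clinear_op (\<lambda>x. A (B x))"
proof -
  obtain K where K: "K > 0" "\<And>x. norm (A x) \<le> K * norm x" using assms(1) bounded_clinear_op_bound by metis
  obtain L where L: "\<And>x. norm (B x) \<le> L * norm x" using assms(2) bounded_clinear_op_bound by metis
  have "norm (A (B x)) \<le> K * L * norm x" for x
    using K(2)[of "B x"] mult_left_mono[OF L[of x], of K] K(1) unfolding mult.assoc by linarith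
  then show ?thesis
    by (intro bounded_clinear_opI[where K="K * L"])
      (auto simp: bounded_clinear_opD(1,2)[OF assms(1)] bounded_clinear_opD(1,2)[OF assms(2)])
qed

lemma bounded_clinear_op_sum:
  assumes "\<And>i. i \<in> S \<Longrightarrow> bounded_clinear_op (A i)"
  shows "bounded_clinear_op (\<lambda>x. \<Sum>i\<in>S. A i x)"
  using assms
  by (induction S rule: infinite_finite_induct)
    (auto intro: bounded_clinear_op_zero bounded_clinear_op_add)

lemma bounded_clinear_op_funpow:
  assumes "bounded_clinear_op A"
  shows "bounded_clinear_op (A ^^ k)"
  using bounded_clinear_op_compose[OF assms]
  by (induction k) (auto simp: bounded_clinear_op_id comp_def)

lemma cinner_adjH_right:
  assumes "bounded_clinear_op A"
  shows "cinner (A x) y = cinner x (adjH A y)"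
proof -
  obtain K where K: "K > 0" "\<And>x. norm (A x) \<le> K * norm x"
    using assms bounded_clinear_op_bound by metis
  have "\<exists>v. \<forall>x. cinner y (A x) = cinner v x"
  proof (rule riesz_representation)
    show "cmod (cinner y (A x)) \<le> norm y * K * norm x" for x
      using cmod_cinner_le[of y "A x"] mult_left_mono[OF K(2)[of x], of "norm y"]
      by (simp add: mult.assoc)
  qed (auto simp: bounded_clinear_opD[OF assms] cinner_add_right cinner_scaleC_right)
  then obtain v where v: "\<And>x. cinner y (A x) = cinner v x" by blast
  have v': "\<forall>x. cinner (A x) y = cinner x v" using v by (metis cinner_commute)
  have "adjH A y = v"
    unfolding adjH_def
  proof (rule the_equality)
    show "w = v" if "\<forall>x. cinner (A x) y = cinner x w" for w
      using that v' by (intro cinner_right_eqI) metis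
  qed (rule v')
  then show ?thesis using v' by blast
qed

lemma cinner_adjH_left:
  assumes "bounded_clinear_op A"
  shows "cinner (adjH A x) y = cinner x (A y)"
  using cinner_adjH_right[OF assms, of y x] by (metis cinner_commute[of "adjH A x" y] cinner_commute[of x "A y"])

lemma adjH_eqI:
  assumes "\<And>x y. cinner (A x) y = cinner x (B y)"
  shows "adjH A = B"
proof
  fix y
  show "adjH A y = B y"
    unfolding adjH_def
  proof (rule the_equality)
    show "w = B y" if "\<forall>x. cinner (A x) y = cinner x w" for w
      using that assms by (intro cinner_right_eqI) metis
  qed (simp add: assms)
qed

lemma bounded_clinear_op_adjH:
  assumes "bounded_clinear_op A"
  shows "bounded_clinear_op (adjH A)"
proof -
  obtain K where K: "K > 0" "\<And>x. norm (A x) \<le> K * norm x"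
    using assms bounded_clinear_op_bound by metis
  show ?thesis
  proof (rule bounded_clinear_opI[where K=K])
    show "adjH A (x + y) = adjH A x + adjH A y" for x y
      by (rule cinner_right_eqI) (simp add: cinner_adjH_right[OF assms, symmetric] cinner_add_right)
    show "adjH A (scaleC c x) = scaleC c (adjH A x)" for c x
      by (rule cinner_right_eqI) (simp add: cinner_adjH_right[OF assms, symmetric] cinner_scaleC_right)
    show "norm (adjH A x) \<le> K * norm x" for x
    proof (cases "adjH A x = 0")
      case False
      have "(norm (adjH A x))\<^sup>2 = Re (cinner (A (adjH A x)) x)"
        by (simp add: norm_square_Re_cinner cinner_adjH_right[OF assms])
      also have "\<dots> \<le> norm (A (adjH A x)) * norm x" by (rule Re_cinner_le)
      also have "\<dots> \<le> K * norm (adjH A x) * norm x" by (intro mult_right_mono K) auto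
      finally show ?thesis using False by (simp add: power2_eq_square mult_ac)
    qed (use K in auto)
  qed
qed

lemma adjH_compose:
  assumes "bounded_clinear_op A" "bounded_clinear_op B"
  shows "adjH (A \<circ> B) = adjH B \<circ> adjH A"
  by (rule adjH_eqI) (simp add: cinner_adjH_right[OF assms(1)] cinner_adjH_right[OF assms(2)])

lemma adjH_id: "adjH id = id"
  by (rule adjH_eqI) simp

lemma has_sum_diff:
  fixes f g :: "'i \<Rightarrow> 'a::real_normed_vector"
  assumes "(f has_sum a) S" "(g has_sum b) S"
  shows "((\<lambda>i. f i - g i) has_sum (a - b)) S"
  using has_sum_add[OF assms(1) assms(2)[THEN has_sum_bounded_linear[OF bounded_linear_minus[OF bounded_linear_ident]]]]
  by (simp add: comp_def)

lemma has_sum_polarization: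
  fixes B :: "'i \<Rightarrow> 'a::complex_hilbert \<Rightarrow> 'a \<Rightarrow> complex" and Q :: "'a \<Rightarrow> 'a \<Rightarrow> complex"
  assumes addB: "\<And>i x y z. B i (x + y) z = B i x z + B i y z" "\<And>i x y z. B i z (x + y) = B i z x + B i z y"
    and scaleB: "\<And>i c x z. B i (scaleC c x) z = cnj c * B i x z" "\<And>i c x z. B i z (scaleC c x) = c * B i z x"
    and addQ: "\<And>x y z. Q (x + y) z = Q x z + Q y z" "\<And>x y z. Q z (x + y) = Q z x + Q z y"
    and scaleQ: "\<And>c x z. Q (scaleC c x) z = cnj c * Q x z" "\<And>c x z. Q z (scaleC c x) = c * Q z x"
    and diag: "\<And>x. ((\<lambda>i. B i x x) has_sum Q x x) S"
  shows "((\<lambda>i. B i x y) has_sum Q x y) S"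
proof -
  define P where "P F = ((F (x + y) (x + y) - F x x - F y y)
    + (- \<i>) * (F (x + scaleC \<i> y) (x + scaleC \<i> y) - F x x - F y y)) * (1/2)"
    for F :: "'a \<Rightarrow> 'a \<Rightarrow> complex"
  have "P (B i) = B i x y" for i by (simp add: P_def addB scaleB algebra_simps)
  moreover have "P Q = Q x y" by (simp add: P_def addQ scaleQ algebra_simps)
  moreover have "((\<lambda>i. P (B i)) has_sum P Q) S"
    unfolding P_def
    by (intro has_sum_cmult_left has_sum_cmult_right has_sum_add has_sum_diff diag)
  ultimately show ?thesis by simp
qed

section \<open>Positive operators and square roots\<close>

lemma pos_op_selfadjoint:
  assumes "bounded_clinear_op A" "pos_op A"
  shows "cinner (A x) y = cinner x (A y)"
proof -
  have im: "Im (cinner z (A z)) = 0" for z using assms(2) by (simp add: pos_op_def)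
  have "Im (cinner x (A y)) + Im (cinner y (A x)) = 0"
    using im[of "x + y"] im[of x] im[of y]
    by (simp add: bounded_clinear_opD[OF assms(1)] cinner_add_left cinner_add_right)
  moreover have "Re (cinner x (A y)) = Re (cinner y (A x))"
    using im[of "x + scaleC \<i> y"] im[of x] im[of y]
    by (simp add: bounded_clinear_opD[OF assms(1)] cinner_add_left cinner_add_right
        cinner_scaleC_left cinner_scaleC_right)
  ultimately have "cinner x (A y) = cnj (cinner y (A x))" by (simp add: complex_eq_iff)
  then show ?thesis using cinner_commute[of "A x" y] by simp
qed

lemma pos_opD: "pos_op A \<Longrightarrow> 0 \<le> Re (cinner x (A x))"
  by (simp add: pos_op_def)

lemma pos_op_norm_bound:
  assumes A: "bounded_clinear_op A" "pos_op A" and K: "K > 0" "\<And>x. norm (A x) \<le> K * norm x"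
  shows "(norm (A x))\<^sup>2 \<le> K * Re (cinner x (A x))"
proof -
  define y where "y = A x"
  define s where "s = 1 / K"
  have "0 \<le> Re (cinner (x - s *\<^sub>R y) (A (x - s *\<^sub>R y)))" by (rule pos_opD[OF A(2)])
  also have "\<dots> = Re (cinner x y) - 2 * s * (norm y)\<^sup>2 + s * s * Re (cinner y (A y))"
    using pos_op_selfadjoint[OF A, of x y]
    by (simp add: bounded_clinear_opD[OF A(1)] cinner_diff_left cinner_diff_right cinner_scaleR_left
        cinner_scaleR_right y_def[symmetric] algebra_simps norm_square_Re_cinner)
  finally have 1: "0 \<le> Re (cinner x y) - 2 * s * (norm y)\<^sup>2 + s * s * Re (cinner y (A y))" .
  have "Re (cinner y (A y)) \<le> norm y * (K * norm y)"
    using Re_cinner_le[of y "A y"] mult_left_mono[OF K(2)[of y], of "norm y"] by simp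
  then have "s * s * Re (cinner y (A y)) \<le> s * s * (K * (norm y)\<^sup>2)"
    by (intro mult_left_mono) (auto simp: power2_eq_square mult_ac)
  also have "\<dots> = s * (norm y)\<^sup>2" using K(1) by (simp add: s_def)
  finally have "s * (norm y)\<^sup>2 \<le> Re (cinner x y)" using 1 by simp
  then show ?thesis using K(1) by (simp add: s_def y_def field_simps)
qed

lemma pos_op_zero_imp:
  assumes A: "bounded_clinear_op A" "pos_op A" and "Re (cinner x (A x)) = 0"
  shows "A x = 0"
proof -
  obtain K where "K > 0" "\<And>x. norm (A x) \<le> K * norm x" using bounded_clinear_op_bound[OF A(1)] by metis
  from pos_op_norm_bound[OF A this, of x] assms(3) show ?thesis by simp
qed

definition sqrt_coeff :: "nat \<Rightarrow> real" where
  "sqrt_coeff k = (- 1) ^ k * ((1/2) gchoose k)"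

lemma sqrt_coeff_0: "sqrt_coeff 0 = 1" by (simp add: sqrt_coeff_def)

lemma sqrt_coeff_Suc: "sqrt_coeff (Suc k) = sqrt_coeff k * ((real k - 1/2) / (real k + 1))"
  by (simp add: sqrt_coeff_def gbinomial_Suc_rec field_simps)

lemma sqrt_coeff_nonpos: "sqrt_coeff (Suc k) \<le> 0"
proof (induction k)
  case 0 show ?case by (simp add: sqrt_coeff_Suc sqrt_coeff_0)
next
  case (Suc k) then show ?case
    by (subst sqrt_coeff_Suc) (intro mult_nonpos_nonneg, auto)
qed

lemma sqrt_coeff_sum_nonneg: "0 \<le> (\<Sum>k\<le>N. sqrt_coeff k)"
proof -
  have "(\<Sum>k\<le>N. sqrt_coeff k) = (- 1) ^ N * ((1/2 - 1 :: real) gchoose N)"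
    unfolding sqrt_coeff_def gbinomial_sum_lower_neg[symmetric] by (simp add: mult.commute)
  also have "\<dots> = (\<Prod>i<N. (1/2 + real i) / (real i + 1))"
    by (induction N) (auto simp: gbinomial_Suc_rec field_simps)
  also have "\<dots> \<ge> 0" by (intro prod_nonneg) auto
  finally show ?thesis .
qed

lemma sqrt_coeff_abs_sum_le: "(\<Sum>k\<le>N. \<bar>sqrt_coeff k\<bar>) \<le> 2"
proof -
  have "(\<Sum>k\<le>N. \<bar>sqrt_coeff k\<bar>) = 2 - (\<Sum>k\<le>N. sqrt_coeff k)"
    by (induction N) (use sqrt_coeff_nonpos in \<open>auto simp: sqrt_coeff_0\<close>)
  then show ?thesis using sqrt_coeff_sum_nonneg[of N] by simp
qed

lemma sqrt_coeff_summable: "summable (\<lambda>k. \<bar>sqrt_coeff k\<bar>)"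
  by (rule summableI_nonneg_bounded[where x=2])
    (auto intro!: order_trans[OF sum_mono2 sqrt_coeff_abs_sum_le] intro: less_imp_le)

lemma sqrt_coeff_abs_has_sum: "(\<lambda>k. \<bar>sqrt_coeff k\<bar>) summable_on UNIV"
  by (rule summable_nonneg_imp_summable_on) (auto simp: sqrt_coeff_summable)

lemma sqrt_coeff_convolution:
  "(\<Sum>i\<le>k. sqrt_coeff i * sqrt_coeff (k - i)) = (if k = 0 then 1 else if k = 1 then -1 else 0)"
proof -
  have "(\<Sum>i\<le>k. sqrt_coeff i * sqrt_coeff (k - i))
      = (\<Sum>i\<le>k. (- 1) ^ k * (((1/2) gchoose i) * ((1/2) gchoose (k - i))))"
    by (intro sum.cong refl) (auto simp: sqrt_coeff_def power_add[symmetric] mult_ac minus_one_power_iff)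
  also have "\<dots> = (- 1) ^ k * ((1/2 + 1/2 :: real) gchoose k)"
    unfolding gbinomial_Vandermonde[symmetric] sum_distrib_left atMost_atLeast0 ..
  also have "(1/2 + 1/2 :: real) gchoose k = of_nat (1 choose k)"
    by (simp add: binomial_gbinomial)
  finally show ?thesis by (cases k; cases "k - 1") auto
qed

definition sqrt_series :: "('a::complex_hilbert \<Rightarrow> 'a) \<Rightarrow> 'a \<Rightarrow> 'a" where
  "sqrt_series B x = (\<Sum>\<^sub>\<infinity>k. sqrt_coeff k *\<^sub>R (B ^^ k) x)"

context
  fixes B :: "'a::complex_hilbert \<Rightarrow> 'a"
  assumes B: "bounded_clinear_op B" and contr: "\<And>x. norm (B x) \<le> norm x"
begin

lemma norm_funpow_contraction: "norm ((B ^^ k) x) \<le> norm x"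
  by (induction k) (auto intro: order_trans[OF contr])

lemma sqrt_series_abs_summable: "(\<lambda>k. norm (sqrt_coeff k *\<^sub>R (B ^^ k) x)) summable_on UNIV"
  by (rule summable_on_comparison_test[OF summable_on_cmult_left[OF sqrt_coeff_abs_has_sum, of "norm x"]])
    (auto intro!: mult_left_mono norm_funpow_contraction)

lemma sqrt_series_has_sum: "((\<lambda>k. sqrt_coeff k *\<^sub>R (B ^^ k) x) has_sum sqrt_series B x) UNIV"
  unfolding sqrt_series_def
  by (rule has_sum_infsum[OF abs_summable_summable[OF sqrt_series_abs_summable]])

lemma bounded_clinear_op_sqrt_series: "bounded_clinear_op (sqrt_series B)"
proof (rule bounded_clinear_opI)
  note Bk = bounded_clinear_opD[OF bounded_clinear_op_funpow[OF B]]
  show "sqrt_series B (x + y) = sqrt_series B x + sqrt_series B y" for x y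
    using has_sum_add[OF sqrt_series_has_sum[of x] sqrt_series_has_sum[of y]] sqrt_series_has_sum[of "x + y"]
    by (auto simp: Bk scaleR_add_right dest: has_sum_unique)
  show "sqrt_series B (scaleC c x) = scaleC c (sqrt_series B x)" for c x
  proof -
    have "bounded_linear (scaleC c :: 'a \<Rightarrow> 'a)"
      by (rule bounded_linear_intro[of _ "cmod c"]) (auto simp: scaleC_add_right scaleC_scaleR norm_scaleC mult.commute)
    from has_sum_bounded_linear[OF this sqrt_series_has_sum[of x]] sqrt_series_has_sum[of "scaleC c x"]
    show ?thesis by (auto simp: Bk scaleC_scaleR dest: has_sum_unique)
  qed
  show "norm (sqrt_series B x) \<le> (\<Sum>\<^sub>\<infinity>k. \<bar>sqrt_coeff k\<bar>) * norm x" for x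
  proof -
    have "norm (sqrt_series B x) \<le> (\<Sum>\<^sub>\<infinity>k. norm (sqrt_coeff k *\<^sub>R (B ^^ k) x))"
      unfolding sqrt_series_def by (rule norm_infsum_bound[OF sqrt_series_abs_summable])
    also have "\<dots> \<le> (\<Sum>\<^sub>\<infinity>k. \<bar>sqrt_coeff k\<bar> * norm x)"
      by (intro infsum_mono sqrt_series_abs_summable summable_on_cmult_left sqrt_coeff_abs_has_sum)
        (auto intro!: mult_left_mono norm_funpow_contraction)
    also have "\<dots> = (\<Sum>\<^sub>\<infinity>k. \<bar>sqrt_coeff k\<bar>) * norm x"
      by (intro infsum_cmult_left) (auto simp: sqrt_coeff_abs_has_sum)
    finally show ?thesis .
  qed
qed

lemma sqrt_series_commute:
  assumes E: "bounded_clinear_op E" and comm: "\<And>x. E (B x) = B (E x)"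
  shows "E (sqrt_series B x) = sqrt_series B (E x)"
proof -
  have "E ((B ^^ k) x) = (B ^^ k) (E x)" for k by (induction k) (auto simp: comm)
  then have "((\<lambda>k. sqrt_coeff k *\<^sub>R (B ^^ k) (E x)) has_sum E (sqrt_series B x)) UNIV"
    using has_sum_bounded_linear[OF bounded_clinear_op_bounded_linear[OF E] sqrt_series_has_sum[of x]]
    by (simp add: bounded_clinear_opD[OF E])
  then show ?thesis using sqrt_series_has_sum[of "E x"] has_sum_unique by blast
qed

text \<open>The Cauchy product of the binomial series of \<open>\<surd>(1 - t)\<close> with itself is \<open>1 - t\<close>.\<close>

lemma sqrt_series_square: "sqrt_series B (sqrt_series B x) = x - B x"
proof -
  define u where "u = (\<lambda>(i, j). (sqrt_coeff i * sqrt_coeff j) *\<^sub>R (B ^^ (i + j)) x)"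
  have "(\<lambda>p. (case p of (i, j) \<Rightarrow> \<bar>sqrt_coeff i\<bar> * \<bar>sqrt_coeff j\<bar>) * norm x) summable_on UNIV \<times> UNIV"
  proof (rule summable_on_cmult_left, rule summable_on_SigmaI)
    show "((\<lambda>j. case (i, j) of (i, j) \<Rightarrow> \<bar>sqrt_coeff i\<bar> * \<bar>sqrt_coeff j\<bar>) has_sum
        (\<bar>sqrt_coeff i\<bar> * (\<Sum>\<^sub>\<infinity>j. \<bar>sqrt_coeff j\<bar>))) UNIV" for i
      unfolding prod.case by (intro has_sum_cmult_right has_sum_infsum sqrt_coeff_abs_has_sum)
    show "(\<lambda>i. \<bar>sqrt_coeff i\<bar> * (\<Sum>\<^sub>\<infinity>j. \<bar>sqrt_coeff j\<bar>)) summable_on UNIV"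
      by (intro summable_on_cmult_left sqrt_coeff_abs_has_sum)
  qed auto
  then have "(\<lambda>p. norm (u p)) summable_on UNIV \<times> UNIV"
    by (rule summable_on_comparison_test)
      (auto simp: u_def abs_mult mult.assoc intro!: mult_left_mono norm_funpow_contraction)
  then have su: "u summable_on UNIV \<times> UNIV" by (rule abs_summable_summable)
  have inner: "((\<lambda>j. u (i, j)) has_sum sqrt_coeff i *\<^sub>R (B ^^ i) (sqrt_series B x)) UNIV" for i
  proof -
    note Bi = bounded_clinear_op_funpow[OF B, of i]
    have "((\<lambda>j. sqrt_coeff i *\<^sub>R (B ^^ i) (sqrt_coeff j *\<^sub>R (B ^^ j) x)) has_sum
        sqrt_coeff i *\<^sub>R (B ^^ i) (sqrt_series B x)) UNIV"
      by (intro has_sum_scaleR has_sum_bounded_linear[OF bounded_clinear_op_bounded_linear[OF Bi]]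
          sqrt_series_has_sum)
    then show ?thesis by (simp add: u_def bounded_clinear_opD[OF Bi] funpow_add)
  qed
  have "infsum u (UNIV \<times> UNIV) = (\<Sum>\<^sub>\<infinity>i. \<Sum>\<^sub>\<infinity>j. u (i, j))"
    by (rule infsum_Sigma_banach[OF su, symmetric])
  also have "\<dots> = sqrt_series B (sqrt_series B x)"
    unfolding infsumI[OF inner] by (simp add: sqrt_series_def)
  finally have 1: "(u has_sum sqrt_series B (sqrt_series B x)) (UNIV \<times> UNIV)"
    using su has_sum_infsum by metis
  have "(u has_sum S) (UNIV \<times> UNIV) \<longleftrightarrow>
      ((\<lambda>(k, i). u (i, k - i)) has_sum S) (SIGMA k:UNIV. {..k})" for S
    by (rule has_sum_reindex_bij_witness[of _ "\<lambda>(k, i). (i, k - i)" "\<lambda>(i, j). (i + j, i)"]) auto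
  then have 2: "((\<lambda>(k, i). u (i, k - i)) has_sum sqrt_series B (sqrt_series B x)) (SIGMA k:UNIV. {..k})"
    using 1 by blast
  have inner2: "((\<lambda>i. u (i, k - i)) has_sum (if k = 0 then x else if k = 1 then - B x else 0)) {..k}" for k
  proof (rule has_sum_finiteI)
    have "(\<Sum>i\<le>k. u (i, k - i)) = (\<Sum>i\<le>k. sqrt_coeff i * sqrt_coeff (k - i)) *\<^sub>R (B ^^ k) x"
      unfolding scaleR_sum_left by (intro sum.cong) (auto simp: u_def)
    then show "(if k = 0 then x else if k = 1 then - B x else 0) = (\<Sum>i\<le>k. u (i, k - i))"
      by (auto simp: sqrt_coeff_convolution)
  qed simp
  have "((\<lambda>k::nat. if k = 0 then x else if k = 1 then - B x else 0) has_sum sqrt_series B (sqrt_series B x)) UNIV"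
    by (rule has_sum_SigmaD[OF 2]) (unfold prod.case, rule inner2)
  moreover have "((\<lambda>k::nat. if k = 0 then x else if k = 1 then - B x else 0) has_sum (x - B x)) UNIV"
    by (rule has_sum_finite_neutralI[of "{0,1}"]) auto
  ultimately show ?thesis by (rule has_sum_unique)
qed

lemma pos_op_sqrt_series:
  assumes sa: "\<And>x y. cinner (B x) y = cinner x (B y)"
  shows "pos_op (sqrt_series B)"
  unfolding pos_op_def
proof (intro allI conjI)
  fix x
  have sak: "cinner ((B ^^ k) x) y = cinner x ((B ^^ k) y)" for k x y
    by (induction k arbitrary: x y) (auto simp: sa funpow_swap1)
  have im: "Im (cinner x ((B ^^ k) x)) = 0" for k
    using sak[of k x x] cinner_commute[of x "(B ^^ k) x"]
    by (metis Reals_cnj_iff complex_is_Real_iff)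
  have hs: "((\<lambda>k. sqrt_coeff k * cinner x ((B ^^ k) x)) has_sum cinner x (sqrt_series B x)) UNIV"
    using has_sum_bounded_linear[OF bounded_linear_cinner_right sqrt_series_has_sum[of x], of x]
    by (simp add: cinner_scaleR_right)
  have "((\<lambda>k. 0) has_sum Im (cinner x (sqrt_series B x))) (UNIV :: nat set)"
    using has_sum_Im[OF hs] by (simp add: im)
  then show "Im (cinner x (sqrt_series B x)) = 0" using has_sum_0_simp has_sum_unique by blast
  have re: "((\<lambda>k. sqrt_coeff k * Re (cinner x ((B ^^ k) x))) has_sum Re (cinner x (sqrt_series B x))) UNIV"
    using has_sum_Re[OF hs] by simp
  have "0 \<le> (\<Sum>k<Suc N. sqrt_coeff k * Re (cinner x ((B ^^ k) x)))" for N
  proof -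
    have "(\<Sum>k\<le>N. sqrt_coeff k) * (norm x)\<^sup>2 = (\<Sum>k\<le>N. sqrt_coeff k * (norm x)\<^sup>2)"
      by (rule sum_distrib_right)
    also have "\<dots> \<le> (\<Sum>k\<le>N. sqrt_coeff k * Re (cinner x ((B ^^ k) x)))"
    proof (rule sum_mono)
      fix k
      show "sqrt_coeff k * (norm x)\<^sup>2 \<le> sqrt_coeff k * Re (cinner x ((B ^^ k) x))"
      proof (cases k)
        case 0 then show ?thesis by (simp add: norm_square_Re_cinner)
      next
        case (Suc l)
        have "Re (cinner x ((B ^^ k) x)) \<le> norm x * norm ((B ^^ k) x)" by (rule Re_cinner_le)
        also have "\<dots> \<le> norm x * norm x" by (intro mult_left_mono norm_funpow_contraction) auto
        finally show ?thesis using sqrt_coeff_nonpos[of l] Suc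
          by (intro mult_left_mono_neg) (auto simp: power2_eq_square)
      qed
    qed
    finally show ?thesis
      using mult_nonneg_nonneg[OF sqrt_coeff_sum_nonneg[of N], of "(norm x)\<^sup>2"]
      unfolding lessThan_Suc_atMost by (meson order_trans zero_le_power2)
  qed
  then show "0 \<le> Re (cinner x (sqrt_series B x))"
    using LIMSEQ_Suc[OF has_sum_imp_sums[OF re, unfolded sums_def]] by (intro LIMSEQ_le_const) auto
qed

end

lemma pos_op_square_roots_eq:
  assumes S: "bounded_clinear_op S" "pos_op S" and R: "bounded_clinear_op R" "pos_op R"
    and sq: "\<And>x. S (S x) = R (R x)" and comm: "\<And>x. S (R x) = R (S x)"
  shows "S = R"
proof
  fix x
  note Sl = bounded_clinear_opD[OF S(1)] and Rl = bounded_clinear_opD[OF R(1)]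
  define d where "d = S x - R x"
  have "S d + R d = 0" by (simp add: d_def Sl Rl sq comm)
  then have "Re (cinner d (S d)) + Re (cinner d (R d)) = 0"
    by (metis cinner_add_right cinner_zero_right plus_complex.sel(1) zero_complex.sel(1))
  then have "Re (cinner d (S d)) = 0" "Re (cinner d (R d)) = 0"
    using pos_opD[OF S(2), of d] pos_opD[OF R(2), of d] by linarith+
  then have "S d = 0" "R d = 0" using pos_op_zero_imp S R by blast+
  then have "cinner d d = 0"
    by (metis (no_types, lifting) cinner_diff_left cinner_zero_right d_def diff_self pos_op_selfadjoint[OF S] pos_op_selfadjoint[OF R])
  then show "S x = R x" by (simp add: d_def cinner_self_norm)
qed

lemma op_sqrt:
  assumes A: "bounded_clinear_op A" "pos_op A"
  shows "bounded_clinear_op (op_sqrt A)" "pos_op (op_sqrt A)" "op_sqrt A (op_sqrt A x) = A x"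
proof -
  obtain K where K: "K > 0" "\<And>x. norm (A x) \<le> K * norm x" using bounded_clinear_op_bound[OF A(1)] by metis
  define B where "B x = x - (1/K) *\<^sub>R A x" for x
  have B: "bounded_clinear_op B"
    unfolding B_def by (intro bounded_clinear_op_diff bounded_clinear_op_id bounded_clinear_op_scaleR A)
  have sa: "cinner (B x) y = cinner x (B y)" for x y
    by (simp add: B_def cinner_diff_left cinner_diff_right cinner_scaleR_left cinner_scaleR_right
        pos_op_selfadjoint[OF A])
  have contr: "norm (B x) \<le> norm x" for x
  proof -
    have "(norm (B x))\<^sup>2 = (norm x)\<^sup>2 - 2 / K * Re (cinner x (A x)) + (1/K)\<^sup>2 * (norm (A x))\<^sup>2"
      unfolding B_def norm_diff_square norm_scaleR power_mult_distrib
      using K(1) by (simp add: cinner_scaleR_right)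
    moreover have "(1/K)\<^sup>2 * (norm (A x))\<^sup>2 \<le> (1/K)\<^sup>2 * (K * Re (cinner x (A x)))"
      by (intro mult_left_mono pos_op_norm_bound[OF A K]) auto
    moreover have "(1/K)\<^sup>2 * (K * Re (cinner x (A x))) = 1 / K * Re (cinner x (A x))"
      using K(1) by (simp add: power2_eq_square)
    ultimately have "(norm (B x))\<^sup>2 \<le> (norm x)\<^sup>2 - 1 / K * Re (cinner x (A x))" by argo
    also have "\<dots> \<le> (norm x)\<^sup>2" using K(1) pos_opD[OF A(2), of x] by simp
    finally show ?thesis by (rule power2_le_imp_le) simp
  qed
  define S where "S x = sqrt K *\<^sub>R sqrt_series B x" for x
  have S: "bounded_clinear_op S"
    unfolding S_def by (intro bounded_clinear_op_scaleR bounded_clinear_op_sqrt_series B contr)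
  have Sp: "pos_op S"
    using pos_op_sqrt_series[OF B contr sa] K(1) by (simp add: pos_op_def S_def cinner_scaleR_right)
  have SS: "S (S x) = A x" for x
  proof -
    have "S (S x) = (sqrt K * sqrt K) *\<^sub>R sqrt_series B (sqrt_series B x)"
      unfolding S_def using bounded_clinear_opD(6)[OF bounded_clinear_op_sqrt_series[OF B contr]] by simp
    also have "\<dots> = A x" using K(1) by (simp add: sqrt_series_square[OF B contr] B_def)
    finally show ?thesis .
  qed
  have uniq: "R = S" if R: "bounded_clinear_op R" "pos_op R" "R \<circ> R = A" for R
  proof -
    have RR: "R (R x) = A x" for x using R(3) by (metis comp_apply)
    have "R (A x) = A (R x)" for x by (metis RR)
    then have "R (B x) = B (R x)" for x by (simp add: B_def bounded_clinear_opD[OF R(1)])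
    then have "R (S x) = S (R x)" for x
      by (simp add: S_def bounded_clinear_opD[OF R(1)] sqrt_series_commute[OF B contr R(1)])
    then show ?thesis using pos_op_square_roots_eq[OF R(1,2) S Sp] by (simp add: RR SS)
  qed
  have "op_sqrt A = S"
    unfolding op_sqrt_def
  proof (rule the_equality)
    show "bounded_clinear_op S \<and> pos_op S \<and> S \<circ> S = A" using S Sp SS by (simp add: fun_eq_iff)
  qed (use uniq in blast)
  then show "bounded_clinear_op (op_sqrt A)" "pos_op (op_sqrt A)" "op_sqrt A (op_sqrt A x) = A x"
    using S Sp SS by auto
qed

section \<open>Multi-indices\<close>

lemma mindex_upd: "\<alpha> \<in> mindex n \<Longrightarrow> i < n \<Longrightarrow> \<alpha>(i := k) \<in> mindex n"
  by (auto simp: mindex_def)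

lemma mindex_zero [simp]: "(\<lambda>_. 0) \<in> mindex n"
  by (simp add: mindex_def)

lemma mabs_zero [simp]: "mabs n (\<lambda>_. 0) = 0"
  by (simp add: mabs_def)

lemma mabs_eq_0_iff: "\<alpha> \<in> mindex n \<Longrightarrow> mabs n \<alpha> = 0 \<longleftrightarrow> \<alpha> = (\<lambda>_. 0)"
  by (auto simp: mabs_def mindex_def fun_eq_iff) (metis lessThan_iff not_le)

lemma mabs_Suc: "i < n \<Longrightarrow> mabs n (\<alpha>(i := Suc (\<alpha> i))) = Suc (mabs n \<alpha>)"
  unfolding mabs_def by (subst (1 2) sum.remove[of _ i]) auto

lemma mfact_Suc: "i < n \<Longrightarrow> mfact n (\<alpha>(i := Suc (\<alpha> i))) = Suc (\<alpha> i) * mfact n \<alpha>"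
  unfolding mfact_def by (subst (1 2) prod.remove[of _ i]) (auto simp: algebra_simps)

lemma mfact_pos: "mfact n \<alpha> > 0"
  unfolding mfact_def by (auto intro: prod_pos)

lemma gammaM_pos: "gammaM n \<alpha> > 0"
  by (simp add: gammaM_def mfact_pos)

lemma rhoM_pos: "rhoM n m \<alpha> > 0"
  by (simp add: rhoM_def mfact_pos)

lemma gammaM_Suc:
  "i < n \<Longrightarrow> gammaM n (\<alpha>(i := Suc (\<alpha> i))) * real (Suc (\<alpha> i)) = real (Suc (mabs n \<alpha>)) * gammaM n \<alpha>"
  using mfact_pos[of n \<alpha>] by (simp add: gammaM_def mabs_Suc mfact_Suc divide_simps del: of_nat_Suc mult_Suc)

lemma rhoM_Suc:
  assumes "i < n" "1 \<le> m"
  shows "rhoM n m (\<alpha>(i := Suc (\<alpha> i))) * real (Suc (\<alpha> i)) = real (m + mabs n \<alpha>) * rhoM n m \<alpha>"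
proof -
  have "fact (m + Suc (mabs n \<alpha>) - 1) = real (m + mabs n \<alpha>) * (fact (m + mabs n \<alpha> - 1) :: real)"
    using assms(2) by (cases "m + mabs n \<alpha>") auto
  then show ?thesis
    using mfact_pos[of n \<alpha>] assms
    by (simp add: rhoM_def mabs_Suc mfact_Suc divide_simps del: of_nat_Suc of_nat_add mult_Suc)
qed

lemma rhoM_eq_gammaM:
  assumes "1 \<le> m"
  shows "rhoM n m \<alpha> = real ((m - 1 + mabs n \<alpha>) choose mabs n \<alpha>) * gammaM n \<alpha>"
  using assms mfact_pos[of n \<alpha>] by (simp add: rhoM_def gammaM_def binomial_fact field_simps)

lemma finite_mindex_level: "finite {\<alpha> \<in> mindex n. mabs n \<alpha> = k}"
proof (rule finite_subset)
  show "{\<alpha> \<in> mindex n. mabs n \<alpha> = k} \<subseteq> {\<alpha>. \<forall>i. (i \<in> {..<n} \<longrightarrow> \<alpha> i \<in> {..k}) \<and> (i \<notin> {..<n} \<longrightarrow> \<alpha> i = 0)}"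
    by (auto simp: mabs_def mindex_def intro: member_le_sum)
  show "finite {\<alpha>. \<forall>i. (i \<in> {..<n} \<longrightarrow> \<alpha> i \<in> {..k}) \<and> (i \<notin> {..<n} \<longrightarrow> \<alpha> i = 0)}"
    by (rule finite_set_of_finite_funs) auto
qed

lemma mindex_level_0: "{\<alpha> \<in> mindex n. mabs n \<alpha> = 0} = {\<lambda>_. 0}"
  by (auto simp: mabs_eq_0_iff)

lemma sum_mindex_level_Suc:
  fixes F :: "nat \<Rightarrow> (nat \<Rightarrow> nat) \<Rightarrow> 'b::comm_monoid_add"
  shows "(\<Sum>i<n. \<Sum>\<alpha>\<in>{\<alpha> \<in> mindex n. mabs n \<alpha> = k}. F i (\<alpha>(i := Suc (\<alpha> i)))) =
    (\<Sum>\<beta>\<in>{\<beta> \<in> mindex n. mabs n \<beta> = Suc k}. \<Sum>i<n. if 1 \<le> \<beta> i then F i \<beta> else 0)"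
proof -
  have "(\<Sum>\<alpha>\<in>{\<alpha> \<in> mindex n. mabs n \<alpha> = k}. F i (\<alpha>(i := Suc (\<alpha> i)))) =
      (\<Sum>\<beta>\<in>{\<beta> \<in> mindex n. mabs n \<beta> = Suc k}. if 1 \<le> \<beta> i then F i \<beta> else 0)" if i: "i < n" for i
  proof -
    have "(\<Sum>\<alpha>\<in>{\<alpha> \<in> mindex n. mabs n \<alpha> = k}. F i (\<alpha>(i := Suc (\<alpha> i)))) =
      (\<Sum>\<beta>\<in>{\<beta> \<in> {\<beta> \<in> mindex n. mabs n \<beta> = Suc k}. 1 \<le> \<beta> i}. F i \<beta>)"
    proof (rule sum.reindex_bij_witness[of _ "\<lambda>\<beta>. \<beta>(i := \<beta> i - 1)" "\<lambda>\<alpha>. \<alpha>(i := Suc (\<alpha> i))"])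
      fix \<beta> assume "\<beta> \<in> {\<beta> \<in> {\<beta> \<in> mindex n. mabs n \<beta> = Suc k}. 1 \<le> \<beta> i}"
      then show "\<beta>(i := \<beta> i - 1) \<in> {\<alpha> \<in> mindex n. mabs n \<alpha> = k}"
        using i mabs_Suc[OF i, of "\<beta>(i := \<beta> i - 1)"] by (auto intro: mindex_upd)
    qed (use i in \<open>auto simp: mabs_Suc mindex_upd\<close>)
    also have "\<dots> = (\<Sum>\<beta>\<in>{\<beta> \<in> mindex n. mabs n \<beta> = Suc k}. if 1 \<le> \<beta> i then F i \<beta> else 0)"
      by (rule sum.inter_filter[OF finite_mindex_level])
    finally show ?thesis .
  qed
  then show ?thesis by (simp add: sum.swap[of _ "{..<n}"])
qed

lemma has_sum_mindex_shift:
  fixes G :: "(nat \<Rightarrow> nat) \<Rightarrow> 'b::{topological_comm_monoid_add,t2_space}"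
  assumes i: "i < n"
  shows "((\<lambda>\<beta>. if 1 \<le> \<beta> i then G \<beta> else 0) has_sum s) (mindex n) \<longleftrightarrow>
    ((\<lambda>\<alpha>. G (\<alpha>(i := Suc (\<alpha> i)))) has_sum s) (mindex n)"
proof -
  have "((\<lambda>\<alpha>. G (\<alpha>(i := Suc (\<alpha> i)))) has_sum s) (mindex n) \<longleftrightarrow> (G has_sum s) {\<beta> \<in> mindex n. 1 \<le> \<beta> i}"
    by (rule has_sum_reindex_bij_witness[of _ "\<lambda>\<beta>. \<beta>(i := \<beta> i - 1)" "\<lambda>\<alpha>. \<alpha>(i := Suc (\<alpha> i))"])
      (use i in \<open>auto simp: mindex_upd\<close>)
  also have "\<dots> \<longleftrightarrow> ((\<lambda>\<beta>. if 1 \<le> \<beta> i then G \<beta> else 0) has_sum s) (mindex n)"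
    by (rule has_sum_cong_neutral) auto
  finally show ?thesis by simp
qed

lemma has_sum_mindex_levels:
  fixes G :: "(nat \<Rightarrow> nat) \<Rightarrow> real"
  assumes hs: "((\<lambda>k. \<Sum>\<alpha>\<in>{\<alpha> \<in> mindex n. mabs n \<alpha> = k}. G \<alpha>) has_sum s) UNIV"
    and nn: "\<And>\<alpha>. 0 \<le> G \<alpha>"
  shows "(G has_sum s) (mindex n)"
proof -
  define L where "L k = {\<alpha> \<in> mindex n. mabs n \<alpha> = k}" for k
  have fin: "((\<lambda>\<alpha>. G (snd (k, \<alpha>))) has_sum (\<Sum>\<alpha>\<in>L k. G \<alpha>)) (L k)" for k
    by (rule has_sum_finiteI) (auto simp: L_def finite_mindex_level)
  have hs': "((\<lambda>k. \<Sum>\<alpha>\<in>L k. G \<alpha>) has_sum s) UNIV" using hs by (simp add: L_def)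
  have "((\<lambda>p. G (snd p)) has_sum s) (Sigma UNIV L)"
    by (rule has_sum_SigmaI[OF fin hs'], rule summable_on_SigmaI[OF fin has_sum_imp_summable[OF hs']])
      (auto simp: nn)
  also have "?this \<longleftrightarrow> (G has_sum s) (mindex n)"
    by (rule has_sum_reindex_bij_witness[of _ "\<lambda>\<alpha>. (mabs n \<alpha>, \<alpha>)" snd]) (auto simp: L_def)
  finally show ?thesis .
qed

section \<open>Commuting tuples\<close>

lemma Tpow_0: "Tpow 0 T \<alpha> = id"
  by (simp add: Tpow_def)

lemma Tpow_Suc: "Tpow (Suc k) T \<alpha> = Tpow k T \<alpha> \<circ> (T k ^^ \<alpha> k)"
proof -
  have "foldr (\<lambda>i acc. (T i ^^ \<alpha> i) \<circ> acc) xs g = foldr (\<lambda>i acc. (T i ^^ \<alpha> i) \<circ> acc) xs id \<circ> g" for xs g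
    by (induction xs) (auto simp: comp_assoc)
  from this[of "[0..<k]" "T k ^^ \<alpha> k"] show ?thesis by (simp add: Tpow_def)
qed

lemma Tpow_zero: "Tpow n T (\<lambda>_. 0) = id"
  by (induction n) (auto simp: Tpow_0 Tpow_Suc)

lemma Tpow_cong: "(\<And>i. i < n \<Longrightarrow> \<alpha> i = \<beta> i) \<Longrightarrow> Tpow n T \<alpha> = Tpow n T \<beta>"
  by (induction n) (auto simp: Tpow_0 Tpow_Suc)

locale commuting_operators =
  fixes n :: nat and T :: "nat \<Rightarrow> 'h::complex_hilbert \<Rightarrow> 'h"
  assumes commuting: "commuting_tuple n T"
begin

lemma T_bounded: "i < n \<Longrightarrow> bounded_clinear_op (T i)"
  using commuting by (simp add: commuting_tuple_def)

lemma T_commute: "i < n \<Longrightarrow> k < n \<Longrightarrow> T i (T k x) = T k (T i x)"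
  using commuting by (metis commuting_tuple_def comp_apply)

lemma Tpow_bounded: "k \<le> n \<Longrightarrow> bounded_clinear_op (Tpow k T \<alpha>)"
proof (induction k)
  case (Suc k)
  then show ?case
    using bounded_clinear_op_compose[OF _ bounded_clinear_op_funpow[OF T_bounded[of k]]]
    by (simp add: Tpow_Suc comp_def)
qed (simp add: Tpow_0 bounded_clinear_op_id)

lemma T_funpow_commute: "i < n \<Longrightarrow> k < n \<Longrightarrow> T i ((T k ^^ l) x) = (T k ^^ l) (T i x)"
  by (induction l) (simp_all add: T_commute[of i k])

lemma T_Tpow_commute: "k \<le> n \<Longrightarrow> i < n \<Longrightarrow> T i (Tpow k T \<alpha> x) = Tpow k T \<alpha> (T i x)"
  by (induction k arbitrary: x) (auto simp: Tpow_0 Tpow_Suc T_funpow_commute)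

lemma Tpow_upd_aux:
  "k \<le> n \<Longrightarrow> i < k \<Longrightarrow> Tpow k T (\<alpha>(i := Suc (\<alpha> i))) x = T i (Tpow k T \<alpha> x)"
proof (induction k arbitrary: x)
  case (Suc k)
  show ?case
  proof (cases "i = k")
    case True
    have "Tpow k T (\<alpha>(i := Suc (\<alpha> i))) = Tpow k T \<alpha>" by (rule Tpow_cong) (use True in auto)
    then show ?thesis using True Suc.prems by (simp add: Tpow_Suc T_Tpow_commute del: fun_upd_apply)
        (simp add: T_Tpow_commute)
  next
    case False
    then show ?thesis using Suc by (simp add: Tpow_Suc)
  qed
qed simp

lemma Tpow_upd: "i < n \<Longrightarrow> Tpow n T (\<alpha>(i := Suc (\<alpha> i))) = T i \<circ> Tpow n T \<alpha>"
  by (auto simp: Tpow_upd_aux)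

lemma adjH_Tpow_upd:
  "i < n \<Longrightarrow> adjH (Tpow n T (\<alpha>(i := Suc (\<alpha> i)))) x = adjH (Tpow n T \<alpha>) (adjH (T i) x)"
  by (simp add: Tpow_upd adjH_compose[OF T_bounded Tpow_bounded])

lemma adjT_bounded: "i < n \<Longrightarrow> bounded_clinear_op (adjH (T i))"
  by (intro bounded_clinear_op_adjH T_bounded)

lemma adjTpow_bounded: "bounded_clinear_op (adjH (Tpow n T \<alpha>))"
  by (intro bounded_clinear_op_adjH Tpow_bounded) simp

lemma sigmaT_funpow:
  "(sigmaT n T ^^ k) X h =
    (\<Sum>\<alpha>\<in>{\<alpha> \<in> mindex n. mabs n \<alpha> = k}. gammaM n \<alpha> *\<^sub>R Tpow n T \<alpha> (X (adjH (Tpow n T \<alpha>) h)))"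
proof (induction k arbitrary: h)
  case 0
  have "gammaM n (\<lambda>_. 0) = 1" by (simp add: gammaM_def mfact_def)
  then show ?case unfolding mindex_level_0 by (simp add: Tpow_zero adjH_id del: id_apply) simp
next
  case (Suc k)
  define F where "F i \<beta> = (real (\<beta> i) / real (mabs n \<beta>) * gammaM n \<beta>) *\<^sub>R
    Tpow n T \<beta> (X (adjH (Tpow n T \<beta>) h))" for i \<beta>
  have "(sigmaT n T ^^ Suc k) X h = (\<Sum>i<n. T i ((sigmaT n T ^^ k) X (adjH (T i) h)))"
    by (simp add: sigmaT_def)
  also have "\<dots> = (\<Sum>i<n. \<Sum>\<alpha>\<in>{\<alpha> \<in> mindex n. mabs n \<alpha> = k}. F i (\<alpha>(i := Suc (\<alpha> i))))"
  proof (intro sum.cong refl)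
    fix i assume "i \<in> {..<n}"
    then have i: "i < n" by simp
    have "T i ((sigmaT n T ^^ k) X (adjH (T i) h)) = (\<Sum>\<alpha>\<in>{\<alpha> \<in> mindex n. mabs n \<alpha> = k}.
        gammaM n \<alpha> *\<^sub>R T i (Tpow n T \<alpha> (X (adjH (Tpow n T \<alpha>) (adjH (T i) h)))))"
      by (simp add: Suc.IH bounded_clinear_opD[OF T_bounded[OF i]])
    also have "\<dots> = (\<Sum>\<alpha>\<in>{\<alpha> \<in> mindex n. mabs n \<alpha> = k}. F i (\<alpha>(i := Suc (\<alpha> i))))"
    proof (intro sum.cong refl)
      fix \<alpha>
      have "real (Suc (\<alpha> i)) / real (Suc (mabs n \<alpha>)) * gammaM n (\<alpha>(i := Suc (\<alpha> i))) = gammaM n \<alpha>"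
        using gammaM_Suc[OF i, of \<alpha>] by (simp add: field_simps)
      then show "gammaM n \<alpha> *\<^sub>R T i (Tpow n T \<alpha> (X (adjH (Tpow n T \<alpha>) (adjH (T i) h)))) =
          F i (\<alpha>(i := Suc (\<alpha> i)))"
        unfolding F_def mabs_Suc[OF i] adjH_Tpow_upd[OF i] by (simp add: Tpow_upd[OF i])
    qed
    finally show "T i ((sigmaT n T ^^ k) X (adjH (T i) h)) =
      (\<Sum>\<alpha>\<in>{\<alpha> \<in> mindex n. mabs n \<alpha> = k}. F i (\<alpha>(i := Suc (\<alpha> i))))" .
  qed
  also have "\<dots> = (\<Sum>\<beta>\<in>{\<beta> \<in> mindex n. mabs n \<beta> = Suc k}. \<Sum>i<n. if 1 \<le> \<beta> i then F i \<beta> else 0)"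
    by (rule sum_mindex_level_Suc)
  also have "\<dots> = (\<Sum>\<beta>\<in>{\<beta> \<in> mindex n. mabs n \<beta> = Suc k}.
      gammaM n \<beta> *\<^sub>R Tpow n T \<beta> (X (adjH (Tpow n T \<beta>) h)))"
  proof (intro sum.cong refl)
    fix \<beta> assume \<beta>: "\<beta> \<in> {\<beta> \<in> mindex n. mabs n \<beta> = Suc k}"
    have "(\<Sum>i<n. if 1 \<le> \<beta> i then F i \<beta> else 0) = (\<Sum>i<n. F i \<beta>)"
      by (intro sum.cong) (auto simp: F_def not_le)
    also have "\<dots> = (\<Sum>i<n. real (\<beta> i) / real (mabs n \<beta>) * gammaM n \<beta>) *\<^sub>R
        Tpow n T \<beta> (X (adjH (Tpow n T \<beta>) h))"
      by (simp add: F_def scaleR_sum_left)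
    also have "(\<Sum>i<n. real (\<beta> i) / real (mabs n \<beta>) * gammaM n \<beta>) = gammaM n \<beta>"
      using \<beta> by (simp add: sum_distrib_right[symmetric] sum_divide_distrib[symmetric] mabs_def flip: of_nat_sum)
    finally show "(\<Sum>i<n. if 1 \<le> \<beta> i then F i \<beta> else 0) =
      gammaM n \<beta> *\<^sub>R Tpow n T \<beta> (X (adjH (Tpow n T \<beta>) h))" .
  qed
  finally show ?case .
qed

lemma cinner_sigmaT_funpow:
  "cinner x ((sigmaT n T ^^ k) X y) = (\<Sum>\<alpha>\<in>{\<alpha> \<in> mindex n. mabs n \<alpha> = k}.
    of_real (gammaM n \<alpha>) * cinner (adjH (Tpow n T \<alpha>) x) (X (adjH (Tpow n T \<alpha>) y)))"
  by (simp add: sigmaT_funpow cinner_sum_right cinner_scaleR_right cinner_adjH_left[OF Tpow_bounded])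

lemma sigmaT_bounded: "bounded_clinear_op X \<Longrightarrow> bounded_clinear_op (sigmaT n T X)"
  unfolding sigmaT_def
  by (intro bounded_clinear_op_sum bounded_clinear_op_compose[OF T_bounded]
      bounded_clinear_op_compose[OF _ adjT_bounded]) auto

lemma DeltaT_0: "DeltaT n T 0 = id"
  by (simp add: DeltaT_def)

lemma DeltaT_Suc: "DeltaT n T (Suc k) = (\<lambda>h. DeltaT n T k h - sigmaT n T (DeltaT n T k) h)"
  by (simp add: DeltaT_def)

lemma DeltaT_bounded: "bounded_clinear_op (DeltaT n T k)"
  by (induction k) (auto simp: DeltaT_0 DeltaT_Suc bounded_clinear_op_id
      intro: bounded_clinear_op_diff sigmaT_bounded)

lemma DeltaT_selfadjoint: "cinner (DeltaT n T k x) y = cinner x (DeltaT n T k y)"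
proof (induction k arbitrary: x y)
  case (Suc k)
  have "cinner (T i (DeltaT n T k (adjH (T i) x))) y = cinner x (T i (DeltaT n T k (adjH (T i) y)))"
    if "i < n" for i
    by (simp add: cinner_adjH_right[OF T_bounded[OF that]] cinner_adjH_left[OF T_bounded[OF that], symmetric] Suc)
  then show ?case
    by (simp add: DeltaT_Suc sigmaT_def cinner_diff_left cinner_diff_right cinner_sum_left cinner_sum_right Suc)
qed (simp add: DeltaT_0)

lemma sigmaT_funpow_DeltaT_Suc:
  "(sigmaT n T ^^ i) (DeltaT n T (Suc k)) x =
    (sigmaT n T ^^ i) (DeltaT n T k) x - (sigmaT n T ^^ Suc i) (DeltaT n T k) x"
proof -
  have "(sigmaT n T ^^ i) (\<lambda>h. X h - Y h) x = (sigmaT n T ^^ i) X x - (sigmaT n T ^^ i) Y x" for X Y x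
    by (simp add: sigmaT_funpow bounded_clinear_opD[OF Tpow_bounded] scaleR_diff_right sum_subtractf)
  then show ?thesis by (simp add: DeltaT_Suc funpow_swap1)
qed

lemma DeltaT_binomial:
  "DeltaT n T k x = (\<Sum>i\<le>k. ((-1) ^ i * real (k choose i)) *\<^sub>R (sigmaT n T ^^ i) id x)"
proof -
  have "(sigmaT n T ^^ j) (DeltaT n T k) x =
      (\<Sum>i\<le>k. ((-1) ^ i * real (k choose i)) *\<^sub>R (sigmaT n T ^^ (i + j)) id x)" for j
  proof (induction k arbitrary: j)
    case (Suc k)
    have "(sigmaT n T ^^ j) (DeltaT n T (Suc k)) x =
        (\<Sum>i\<le>k. ((-1) ^ i * real (k choose i)) *\<^sub>R (sigmaT n T ^^ (i + j)) id x)
        + (\<Sum>i\<le>k. ((-1) ^ Suc i * real (k choose i)) *\<^sub>R (sigmaT n T ^^ (Suc i + j)) id x)"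
      unfolding sigmaT_funpow_DeltaT_Suc Suc.IH by (simp add: sum_negf)
    also have "(\<Sum>i\<le>k. ((-1) ^ i * real (k choose i)) *\<^sub>R (sigmaT n T ^^ (i + j)) id x)
        = (\<Sum>i\<le>Suc k. ((-1) ^ i * real (k choose i)) *\<^sub>R (sigmaT n T ^^ (i + j)) id x)" by simp
    also have "\<dots> = (sigmaT n T ^^ j) id x
        + (\<Sum>i\<le>k. ((-1) ^ Suc i * real (k choose Suc i)) *\<^sub>R (sigmaT n T ^^ (Suc i + j)) id x)"
      by (subst sum.atMost_Suc_shift) simp
    finally have "(sigmaT n T ^^ j) (DeltaT n T (Suc k)) x = (sigmaT n T ^^ j) id x
        + (\<Sum>i\<le>k. ((-1) ^ Suc i * real (Suc k choose Suc i)) *\<^sub>R (sigmaT n T ^^ (Suc i + j)) id x)"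
      unfolding add.assoc sum.distrib[symmetric] by (simp add: algebra_simps)
    then show ?case by (subst sum.atMost_Suc_shift) simp
  qed (simp add: DeltaT_0)
  from this[of 0] show ?thesis by simp
qed

text \<open>The operator identity behind \<open>(1 - (1 - t)\<^sup>m) / t = \<Sum>\<^bsub>k<m\<^esub> (1 - t)\<^sup>k\<close>.\<close>

lemma sum_DeltaT:
  "(\<Sum>k<m. DeltaT n T k x) = (\<Sum>k<m. ((-1) ^ k * of_nat (m choose (k + 1))) *\<^sub>R
      (\<Sum>\<alpha>\<in>{\<alpha>\<in>mindex n. mabs n \<alpha> = k}. gammaM n \<alpha> *\<^sub>R Tpow n T \<alpha> (adjH (Tpow n T \<alpha>) x)))"
proof -
  have "(\<Sum>k<m. DeltaT n T k x) = (\<Sum>k<m. ((-1) ^ k * of_nat (m choose (k + 1))) *\<^sub>R (sigmaT n T ^^ k) id x)"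
  proof (induction m)
    case (Suc m)
    have "(\<Sum>k<m. ((-1) ^ k * of_nat (m choose (k + 1))) *\<^sub>R (sigmaT n T ^^ k) id x) =
        (\<Sum>k\<le>m. ((-1) ^ k * of_nat (m choose (k + 1))) *\<^sub>R (sigmaT n T ^^ k) id x)"
      by (simp add: lessThan_Suc_atMost[symmetric])
    then have "(\<Sum>k<Suc m. DeltaT n T k x) =
        (\<Sum>k\<le>m. ((-1) ^ k * of_nat (m choose (k + 1))) *\<^sub>R (sigmaT n T ^^ k) id x) +
        (\<Sum>k\<le>m. ((-1) ^ k * of_nat (m choose k)) *\<^sub>R (sigmaT n T ^^ k) id x)"
      by (simp only: sum.lessThan_Suc Suc DeltaT_binomial[of m])
    also have "\<dots> = (\<Sum>k\<le>m. ((-1) ^ k * of_nat (Suc m choose (k + 1))) *\<^sub>R (sigmaT n T ^^ k) id x)"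
      unfolding sum.distrib[symmetric] scaleR_add_left[symmetric]
      by (intro sum.cong refl arg_cong2[where f=scaleR]) (simp add: algebra_simps)
    finally show ?case by (simp only: lessThan_Suc_atMost)
  qed simp
  then show ?thesis by (simp add: sigmaT_funpow)
qed

end

section \<open>Pure hypercontractions\<close>

lemma sum_choose_shift: "(\<Sum>e<m. (e + j) choose j) = (m + j) choose Suc j"
  by (induction m) auto

lemma has_sum_sum:
  fixes F :: "'e \<Rightarrow> 'i \<Rightarrow> 'b::topological_comm_monoid_add"
  assumes "\<And>e. e \<in> E \<Longrightarrow> (F e has_sum s e) S"
  shows "((\<lambda>i. \<Sum>e\<in>E. F e i) has_sum (\<Sum>e\<in>E. s e)) S"
  using assms by (induction E rule: infinite_finite_induct) (auto intro: has_sum_add)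

locale pure_hypercontraction = commuting_operators n T
  for n :: nat and T :: "nat \<Rightarrow> 'h::complex_hilbert \<Rightarrow> 'h" +
  fixes m :: nat
  assumes m: "1 \<le> m" and DeltaT_pos: "pos_op (DeltaT n T m)" and pure: "pure_tuple n T"
begin

abbreviation "C \<equiv> defectC n m T"
abbreviation "\<D> \<equiv> defectD n m T"
abbreviation "j \<equiv> jmap n m T"
abbreviation "adjTpow \<alpha> \<equiv> adjH (Tpow n T \<alpha>)"

lemma C_bounded: "bounded_clinear_op C" and C_pos: "pos_op C" and C_square: "C (C x) = DeltaT n T m x"
  unfolding defectC_def using op_sqrt[OF DeltaT_bounded DeltaT_pos] by auto

lemma C_selfadjoint: "cinner (C x) y = cinner x (C y)"
  by (rule pos_op_selfadjoint[OF C_bounded C_pos])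

definition defect_form :: "nat \<Rightarrow> nat \<Rightarrow> 'h \<Rightarrow> real" where
  "defect_form k i x = Re (cinner x ((sigmaT n T ^^ i) (DeltaT n T k) x))"

lemma defect_form_telescope: "defect_form (Suc k) i x = defect_form k i x - defect_form k (Suc i) x"
  unfolding defect_form_def sigmaT_funpow_DeltaT_Suc by (simp add: cinner_diff_right)

lemma defect_form_tendsto_0: "(\<lambda>i. defect_form k i x) \<longlonglongrightarrow> 0"
proof -
  obtain K where K: "K > 0" "\<And>x. norm (DeltaT n T k x) \<le> K * norm x"
    using bounded_clinear_op_bound[OF DeltaT_bounded] by metis
  have bound: "\<bar>defect_form k i x\<bar> \<le> K * Re (cinner x ((sigmaT n T ^^ i) id x))" for i
  proof -
    let ?L = "{\<alpha> \<in> mindex n. mabs n \<alpha> = i}"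
    have "\<bar>defect_form k i x\<bar> \<le> (\<Sum>\<alpha>\<in>?L. \<bar>gammaM n \<alpha> * Re (cinner (adjTpow \<alpha> x) (DeltaT n T k (adjTpow \<alpha> x)))\<bar>)"
      unfolding defect_form_def cinner_sigmaT_funpow by (simp add: sum_abs)
    also have "\<dots> \<le> (\<Sum>\<alpha>\<in>?L. K * (gammaM n \<alpha> * (norm (adjTpow \<alpha> x))\<^sup>2))"
    proof (rule sum_mono)
      fix \<alpha>
      let ?y = "adjTpow \<alpha> x"
      have "\<bar>Re (cinner ?y (DeltaT n T k ?y))\<bar> \<le> norm ?y * norm (DeltaT n T k ?y)"
        using abs_Re_le_cmod cmod_cinner_le order_trans by blast
      also have "\<dots> \<le> norm ?y * (K * norm ?y)" by (intro mult_left_mono K) auto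
      finally have "\<bar>Re (cinner ?y (DeltaT n T k ?y))\<bar> \<le> K * (norm ?y)\<^sup>2" by (simp add: power2_eq_square mult_ac)
      then have "gammaM n \<alpha> * \<bar>Re (cinner ?y (DeltaT n T k ?y))\<bar> \<le> gammaM n \<alpha> * (K * (norm ?y)\<^sup>2)"
        using gammaM_pos[of n \<alpha>] by (intro mult_left_mono) auto
      then show "\<bar>gammaM n \<alpha> * Re (cinner ?y (DeltaT n T k ?y))\<bar> \<le> K * (gammaM n \<alpha> * (norm ?y)\<^sup>2)"
        using gammaM_pos[of n \<alpha>] by (simp add: abs_mult mult_ac)
    qed
    also have "\<dots> = K * Re (cinner x ((sigmaT n T ^^ i) id x))"
      unfolding cinner_sigmaT_funpow by (simp add: sum_distrib_left norm_square_Re_cinner)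
    finally show ?thesis .
  qed
  have "(\<lambda>i. (sigmaT n T ^^ i) id x) \<longlonglongrightarrow> 0" using pure by (simp add: pure_tuple_def)
  then have "(\<lambda>i. K * Re (cinner x ((sigmaT n T ^^ i) id x))) \<longlonglongrightarrow> K * Re (cinner x 0)"
    by (intro tendsto_mult tendsto_const tendsto_Re bounded_linear.tendsto[OF bounded_linear_cinner_right])
  then have lim: "(\<lambda>i. K * Re (cinner x ((sigmaT n T ^^ i) id x))) \<longlonglongrightarrow> 0"
    by (simp only: cinner_zero_right zero_complex.sel mult_zero_right)
  show ?thesis
    by (rule Lim_null_comparison[OF always_eventually lim]) (simp only: real_norm_def bound simp_thms)
qed

lemma defect_form_sums: "(\<lambda>l. defect_form (Suc k) (i + l) x) sums defect_form k i x"
proof -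
  have "(\<Sum>l<N. defect_form (Suc k) (i + l) x) = defect_form k i x - defect_form k (i + N) x" for N
    by (induction N) (auto simp: defect_form_telescope)
  moreover have "(\<lambda>N. defect_form k i x - defect_form k (i + N) x) \<longlonglongrightarrow> defect_form k i x - 0"
    using LIMSEQ_ignore_initial_segment[OF defect_form_tendsto_0[of k x], of i]
    by (intro tendsto_intros) (simp add: add.commute)
  ultimately show ?thesis by (simp add: sums_def)
qed

lemma defect_form_m: "defect_form m i x =
  (\<Sum>\<alpha>\<in>{\<alpha> \<in> mindex n. mabs n \<alpha> = i}. gammaM n \<alpha> * (norm (C (adjTpow \<alpha> x)))\<^sup>2)"
  unfolding defect_form_def cinner_sigmaT_funpow
  by (simp add: C_square[symmetric] C_selfadjoint[symmetric] norm_square_Re_cinner)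

lemma defect_form_m_nonneg: "0 \<le> defect_form m i x"
  unfolding defect_form_m by (intro sum_nonneg mult_nonneg_nonneg less_imp_le[OF gammaM_pos]) auto

lemma defect_form_has_sum:
  assumes "e < m"
  shows "((\<lambda>l. real ((e + l) choose l) * defect_form m (i + l) x) has_sum defect_form (m - Suc e) i x) UNIV"
  using assms
proof (induction e arbitrary: i)
  case 0
  have "(\<lambda>l. defect_form (Suc (m - Suc 0)) (i + l) x) sums defect_form (m - Suc 0) i x"
    by (rule defect_form_sums)
  then show ?case using 0 by (intro sums_nonneg_imp_has_sum) (auto simp: defect_form_m_nonneg)
next
  case (Suc e)
  then have IH: "((\<lambda>l. real ((e + l) choose l) * defect_form m (i + l) x) has_sum defect_form (m - Suc e) i x) UNIV" for i
    by simp
  have eq: "m - Suc e = Suc (m - Suc (Suc e))" using Suc.prems by simp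
  have "0 \<le> defect_form (m - Suc e) i x" for i
    by (rule has_sum_nonneg[OF IH]) (simp add: defect_form_m_nonneg)
  then have outer: "((\<lambda>l. defect_form (m - Suc e) (i + l) x) has_sum defect_form (m - Suc (Suc e)) i x) UNIV"
    using defect_form_sums[of "m - Suc (Suc e)" i x] unfolding eq
    by (intro sums_nonneg_imp_has_sum) auto
  define G where "G = (\<lambda>(l, k). real ((e + k) choose k) * defect_form m (i + l + k) x)"
  have inner: "((\<lambda>k. G (l, k)) has_sum defect_form (m - Suc e) (i + l) x) UNIV" for l
    using IH[of "i + l"] by (simp add: G_def)
  have "(G has_sum defect_form (m - Suc (Suc e)) i x) (UNIV \<times> UNIV)"
    by (rule has_sum_SigmaI[OF inner outer], rule summable_on_SigmaI[OF inner has_sum_imp_summable[OF outer]])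
      (auto simp: G_def defect_form_m_nonneg)
  also have "?this \<longleftrightarrow> ((\<lambda>(k, l). G (k - l, l)) has_sum defect_form (m - Suc (Suc e)) i x) (SIGMA k:UNIV. {..k})"
    by (rule has_sum_reindex_bij_witness[of _ "\<lambda>(k, l). (k - l, l)" "\<lambda>(k, l). (k + l, l)"]) auto
  finally show ?case
  proof (rule has_sum_SigmaD)
    fix k :: nat
    have "(\<Sum>l\<le>k. G (k - l, l)) = (\<Sum>l\<le>k. real ((e + l) choose l) * defect_form m (i + k) x)"
      by (intro sum.cong) (auto simp: G_def)
    also have "\<dots> = real (\<Sum>l\<le>k. (e + l) choose l) * defect_form m (i + k) x"
      by (simp add: sum_distrib_right)
    also have "\<dots> = real ((Suc e + k) choose k) * defect_form m (i + k) x"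
      by (simp add: sum_choose_lower)
    finally show "((\<lambda>l. case (k, l) of (k, l) \<Rightarrow> G (k - l, l)) has_sum
        real ((Suc e + k) choose k) * defect_form m (i + k) x) {..k}"
      by (intro has_sum_finiteI) auto
  qed
qed

lemma DeltaT_has_sum:
  assumes "e < m"
  shows "((\<lambda>\<alpha>. of_real (real ((e + mabs n \<alpha>) choose mabs n \<alpha>) * gammaM n \<alpha>) *
      cinner (C (adjTpow \<alpha> x)) (C (adjTpow \<alpha> y))) has_sum cinner x (DeltaT n T (m - Suc e) y)) (mindex n)"
proof (rule has_sum_polarization[where x=x and y=y and Q="\<lambda>x y. cinner x (DeltaT n T (m - Suc e) y)"
      and B="\<lambda>\<alpha> x y. of_real (real ((e + mabs n \<alpha>) choose mabs n \<alpha>) * gammaM n \<alpha>) *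
        cinner (C (adjTpow \<alpha> x)) (C (adjTpow \<alpha> y))"])
  fix x
  let ?G = "\<lambda>\<alpha>. real ((e + mabs n \<alpha>) choose mabs n \<alpha>) * (gammaM n \<alpha> * (norm (C (adjTpow \<alpha> x)))\<^sup>2)"
  have "((\<lambda>k. \<Sum>\<alpha>\<in>{\<alpha> \<in> mindex n. mabs n \<alpha> = k}. ?G \<alpha>) has_sum defect_form (m - Suc e) 0 x) UNIV"
    using defect_form_has_sum[OF assms, of 0 x] by (simp add: defect_form_m sum_distrib_left)
  then have "(?G has_sum defect_form (m - Suc e) 0 x) (mindex n)"
    by (rule has_sum_mindex_levels) (simp add: less_imp_le[OF gammaM_pos])
  then have *: "((\<lambda>\<alpha>. complex_of_real (?G \<alpha>)) has_sum of_real (defect_form (m - Suc e) 0 x)) (mindex n)"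
    by (rule has_sum_of_real)
  have "Im (cinner x (DeltaT n T (m - Suc e) x)) = 0"
    using DeltaT_selfadjoint[of "m - Suc e" x x] cinner_commute[of x "DeltaT n T (m - Suc e) x"]
    by (metis Reals_cnj_iff complex_is_Real_iff)
  then have "of_real (defect_form (m - Suc e) 0 x) = cinner x (DeltaT n T (m - Suc e) x)"
    by (simp add: defect_form_def complex_eq_iff)
  with * show "((\<lambda>\<alpha>. of_real (real ((e + mabs n \<alpha>) choose mabs n \<alpha>) * gammaM n \<alpha>) *
      cinner (C (adjTpow \<alpha> x)) (C (adjTpow \<alpha> x))) has_sum cinner x (DeltaT n T (m - Suc e) x)) (mindex n)"
    by (simp add: cinner_self_norm mult.assoc)
qed (simp_all add: bounded_clinear_opD[OF C_bounded] bounded_clinear_opD[OF adjTpow_bounded]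
    bounded_clinear_opD[OF DeltaT_bounded] cinner_add_left cinner_add_right cinner_scaleC_left
    cinner_scaleC_right algebra_simps)

lemma cinner_has_sum:
  "((\<lambda>\<alpha>. of_real (rhoM n m \<alpha>) * cinner (C (adjTpow \<alpha> x)) (C (adjTpow \<alpha> y))) has_sum cinner x y) (mindex n)"
  using DeltaT_has_sum[of "m - 1" x y] m by (simp add: DeltaT_0 rhoM_eq_gammaM)

lemma sum_DeltaT_has_sum:
  "((\<lambda>\<alpha>. of_real (real (m + mabs n \<alpha>) / real (Suc (mabs n \<alpha>)) * rhoM n m \<alpha>) *
      cinner (C (adjTpow \<alpha> x)) (C (adjTpow \<alpha> y))) has_sum cinner x (\<Sum>k<m. DeltaT n T k y)) (mindex n)"
proof -
  have "((\<lambda>\<alpha>. \<Sum>e<m. of_real (real ((e + mabs n \<alpha>) choose mabs n \<alpha>) * gammaM n \<alpha>) *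
      cinner (C (adjTpow \<alpha> x)) (C (adjTpow \<alpha> y))) has_sum
      (\<Sum>e<m. cinner x (DeltaT n T (m - Suc e) y))) (mindex n)"
    using DeltaT_has_sum by (intro has_sum_sum) auto
  moreover have "(\<Sum>e<m. cinner x (DeltaT n T (m - Suc e) y)) = cinner x (\<Sum>k<m. DeltaT n T k y)"
    by (simp add: cinner_sum_right sum.nat_diff_reindex[of "\<lambda>k. cinner x (DeltaT n T k y)"])
  moreover have "(\<Sum>e<m. of_real (real ((e + mabs n \<alpha>) choose mabs n \<alpha>) * gammaM n \<alpha>) *
      cinner (C (adjTpow \<alpha> x)) (C (adjTpow \<alpha> y))) =
      of_real (real (m + mabs n \<alpha>) / real (Suc (mabs n \<alpha>)) * rhoM n m \<alpha>) *
      cinner (C (adjTpow \<alpha> x)) (C (adjTpow \<alpha> y))" for \<alpha>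
  proof -
    let ?k = "mabs n \<alpha>"
    have "Suc ?k * ((m + ?k) choose Suc ?k) = (m + ?k) * ((m + ?k - 1) choose ?k)"
      using m Suc_times_binomial_eq[of "m + ?k - 1" ?k] by (simp add: mult.commute)
    then have "real (Suc ?k) * real ((m + ?k) choose Suc ?k) = real (m + ?k) * real ((m + ?k - 1) choose ?k)"
      by (metis of_nat_mult)
    moreover have "m + ?k - 1 = m - 1 + ?k" using m by simp
    ultimately have "real ((m + ?k) choose Suc ?k) = real (m + ?k) / real (Suc ?k) * real ((m - 1 + ?k) choose ?k)"
      by (simp add: field_simps del: of_nat_Suc of_nat_add)
    then have *: "(\<Sum>e<m. real ((e + ?k) choose ?k)) * gammaM n \<alpha> = real (m + ?k) / real (Suc ?k) * rhoM n m \<alpha>"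
      unfolding of_nat_sum[symmetric] sum_choose_shift rhoM_eq_gammaM[OF m] by simp
    show ?thesis unfolding *[symmetric] of_real_mult of_real_sum sum_distrib_right ..
  qed
  ultimately show ?thesis by simp
qed

end

section \<open>The space \<open>H\<^sub>m\<close>\<close>

lemma const_fn_simps [simp]: "const_fn c (\<lambda>_. 0) = c" "\<alpha> \<noteq> (\<lambda>_. 0) \<Longrightarrow> const_fn c \<alpha> = 0"
  by (auto simp: const_fn_def)

definition Mz_adj :: "nat \<Rightarrow> nat \<Rightarrow> nat \<Rightarrow> ((nat \<Rightarrow> nat) \<Rightarrow> 'a::real_vector) \<Rightarrow> (nat \<Rightarrow> nat) \<Rightarrow> 'a" where
  "Mz_adj n m i g = (\<lambda>\<alpha>. if \<alpha> \<in> mindex n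
     then (real (Suc (\<alpha> i)) / real (m + mabs n \<alpha>)) *\<^sub>R g (\<alpha>(i := Suc (\<alpha> i))) else 0)"

locale Hm_space =
  fixes n m :: nat and D :: "'a::complex_hilbert set"
  assumes m: "1 \<le> m" and D_zero: "0 \<in> D" and D_add: "\<And>x y. x \<in> D \<Longrightarrow> y \<in> D \<Longrightarrow> x + y \<in> D"
    and D_scaleC: "\<And>c x. x \<in> D \<Longrightarrow> scaleC c x \<in> D"
begin

abbreviation "\<H> \<equiv> Hm n m D"
abbreviation "ip \<equiv> hm_inner n m :: ((nat \<Rightarrow> nat) \<Rightarrow> 'a) \<Rightarrow> _"
abbreviation "\<rho> \<equiv> rhoM n m"

lemma D_scaleR: "x \<in> D \<Longrightarrow> r *\<^sub>R x \<in> D"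
  using D_scaleC[of x "of_real r"] by (simp add: scaleC_of_real)

lemma HmD:
  assumes "f \<in> \<H>"
  shows "\<alpha> \<notin> mindex n \<Longrightarrow> f \<alpha> = 0" "f \<alpha> \<in> D" "(\<lambda>\<alpha>. (norm (f \<alpha>))\<^sup>2 / \<rho> \<alpha>) summable_on mindex n"
  using assms by (auto simp: Hm_def)

lemma HmI:
  assumes "\<And>\<alpha>. \<alpha> \<notin> mindex n \<Longrightarrow> f \<alpha> = 0" "\<And>\<alpha>. \<alpha> \<in> mindex n \<Longrightarrow> f \<alpha> \<in> D"
    "(\<lambda>\<alpha>. (norm (f \<alpha>))\<^sup>2 / \<rho> \<alpha>) summable_on mindex n"
  shows "f \<in> \<H>"
  using assms D_zero unfolding Hm_def mem_Collect_eq by metis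

lemma Hm_zero: "(\<lambda>_. 0) \<in> \<H>"
  by (rule HmI) (auto simp: D_zero)

lemma Hm_scaleR_bounded:
  assumes f: "f \<in> \<H>" and w: "\<And>\<alpha>. \<alpha> \<in> mindex n \<Longrightarrow> \<bar>w \<alpha>\<bar> \<le> K"
  shows "(\<lambda>\<alpha>. w \<alpha> *\<^sub>R f \<alpha>) \<in> \<H>"
proof (rule HmI)
  have "(\<lambda>\<alpha>. K\<^sup>2 * ((norm (f \<alpha>))\<^sup>2 / \<rho> \<alpha>)) summable_on mindex n"
    by (intro summable_on_cmult_right HmD(3) f)
  then show "(\<lambda>\<alpha>. (norm (w \<alpha> *\<^sub>R f \<alpha>))\<^sup>2 / \<rho> \<alpha>) summable_on mindex n"
  proof (rule summable_on_comparison_test)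
    fix \<alpha> assume "\<alpha> \<in> mindex n"
    then have "(w \<alpha>)\<^sup>2 \<le> K\<^sup>2" using w[of \<alpha>] by (simp add: abs_le_square_iff[symmetric])
    then have "(w \<alpha>)\<^sup>2 * ((norm (f \<alpha>))\<^sup>2 / \<rho> \<alpha>) \<le> K\<^sup>2 * ((norm (f \<alpha>))\<^sup>2 / \<rho> \<alpha>)"
      by (rule mult_right_mono) (simp add: less_imp_le[OF rhoM_pos])
    then show "(norm (w \<alpha> *\<^sub>R f \<alpha>))\<^sup>2 / \<rho> \<alpha> \<le> K\<^sup>2 * ((norm (f \<alpha>))\<^sup>2 / \<rho> \<alpha>)"
      by (simp add: power_mult_distrib)
  qed (simp add: less_imp_le[OF rhoM_pos])
qed (use f in \<open>auto simp: HmD D_scaleR\<close>)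

lemma Hm_add:
  assumes f: "f \<in> \<H>" and g: "g \<in> \<H>"
  shows "(\<lambda>\<alpha>. f \<alpha> + g \<alpha>) \<in> \<H>"
proof (rule HmI)
  have "(\<lambda>\<alpha>. 2 * ((norm (f \<alpha>))\<^sup>2 / \<rho> \<alpha>) + 2 * ((norm (g \<alpha>))\<^sup>2 / \<rho> \<alpha>)) summable_on mindex n"
    by (intro summable_on_add summable_on_cmult_right HmD(3) f g)
  then show "(\<lambda>\<alpha>. (norm (f \<alpha> + g \<alpha>))\<^sup>2 / \<rho> \<alpha>) summable_on mindex n"
  proof (rule summable_on_comparison_test)
    fix \<alpha> assume "\<alpha> \<in> mindex n"
    have "(norm (f \<alpha> + g \<alpha>))\<^sup>2 \<le> 2 * (norm (f \<alpha>))\<^sup>2 + 2 * (norm (g \<alpha>))\<^sup>2"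
      using cmod_cinner_le_half[of "f \<alpha>" "g \<alpha>"] complex_Re_le_cmod[of "cinner (f \<alpha>) (g \<alpha>)"]
      unfolding norm_add_square by argo
    from divide_right_mono[OF this less_imp_le[OF rhoM_pos[of n m \<alpha>]]]
    show "(norm (f \<alpha> + g \<alpha>))\<^sup>2 / \<rho> \<alpha> \<le> 2 * ((norm (f \<alpha>))\<^sup>2 / \<rho> \<alpha>) + 2 * ((norm (g \<alpha>))\<^sup>2 / \<rho> \<alpha>)"
      by (simp add: add_divide_distrib)
  qed (simp add: less_imp_le[OF rhoM_pos])
qed (use f g in \<open>auto simp: HmD D_add\<close>)

lemma Hm_diff:
  assumes f: "f \<in> \<H>" and g: "g \<in> \<H>"
  shows "(\<lambda>\<alpha>. f \<alpha> - g \<alpha>) \<in> \<H>"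
  using Hm_add[OF f Hm_scaleR_bounded[OF g, of "\<lambda>_. -1" 1]] by simp

lemma Hm_sum: "(\<And>i. i \<in> S \<Longrightarrow> F i \<in> \<H>) \<Longrightarrow> (\<lambda>\<alpha>. \<Sum>i\<in>S. F i \<alpha>) \<in> \<H>"
  by (induction S rule: infinite_finite_induct) (auto simp: Hm_zero Hm_add)

lemma Hm_const:
  assumes "c \<in> D" shows "const_fn c \<in> \<H>"
proof (rule HmI)
  show "(\<lambda>\<alpha>. (norm (const_fn c \<alpha>))\<^sup>2 / \<rho> \<alpha>) summable_on mindex n"
    by (rule finite_nonzero_values_imp_summable_on)
      (rule finite_subset[of _ "{\<lambda>_. 0}"], auto simp: const_fn_def)
qed (use assms D_zero in \<open>auto simp: const_fn_def\<close>)

lemma hm_inner_norm_summable: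
  assumes f: "f \<in> \<H>" and g: "g \<in> \<H>"
  shows "(\<lambda>\<alpha>. norm (cinner (f \<alpha>) (g \<alpha>) / complex_of_real (\<rho> \<alpha>))) summable_on mindex n"
proof (rule summable_on_comparison_test)
  show "(\<lambda>\<alpha>. (norm (f \<alpha>))\<^sup>2 / \<rho> \<alpha> + (norm (g \<alpha>))\<^sup>2 / \<rho> \<alpha>) summable_on mindex n"
    by (intro summable_on_add HmD(3) f g)
  fix \<alpha>
  have "norm (cinner (f \<alpha>) (g \<alpha>)) \<le> (norm (f \<alpha>))\<^sup>2 + (norm (g \<alpha>))\<^sup>2"
    using cmod_cinner_le_half[of "f \<alpha>" "g \<alpha>"] norm_ge_zero[of "cinner (f \<alpha>) (g \<alpha>)"] by argo
  from divide_right_mono[OF this less_imp_le[OF rhoM_pos[of n m \<alpha>]]]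
  show "norm (cinner (f \<alpha>) (g \<alpha>) / complex_of_real (\<rho> \<alpha>)) \<le> (norm (f \<alpha>))\<^sup>2 / \<rho> \<alpha> + (norm (g \<alpha>))\<^sup>2 / \<rho> \<alpha>"
    using rhoM_pos[of n m \<alpha>] by (simp add: norm_divide add_divide_distrib)
qed auto

lemma hm_inner_has_sum:
  assumes "f \<in> \<H>" and "g \<in> \<H>"
  shows "((\<lambda>\<alpha>. cinner (f \<alpha>) (g \<alpha>) / complex_of_real (\<rho> \<alpha>)) has_sum ip f g) (mindex n)"
  unfolding hm_inner_def by (rule has_sum_infsum[OF abs_summable_summable[OF hm_inner_norm_summable[OF assms]]])

lemma hm_inner_add_right:
  assumes "f \<in> \<H>" "g \<in> \<H>" "h \<in> \<H>"
  shows "ip f (\<lambda>\<alpha>. g \<alpha> + h \<alpha>) = ip f g + ip f h"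
  using has_sum_add[OF hm_inner_has_sum[OF assms(1,2)] hm_inner_has_sum[OF assms(1,3)]]
  unfolding hm_inner_def[of n m f "\<lambda>\<alpha>. g \<alpha> + h \<alpha>"]
  by (intro infsumI) (simp add: cinner_add_right add_divide_distrib)

lemma hm_inner_diff_right:
  assumes "f \<in> \<H>" "g \<in> \<H>" "h \<in> \<H>"
  shows "ip f (\<lambda>\<alpha>. g \<alpha> - h \<alpha>) = ip f g - ip f h"
  using has_sum_diff[OF hm_inner_has_sum[OF assms(1,2)] hm_inner_has_sum[OF assms(1,3)]]
  unfolding hm_inner_def[of n m f "\<lambda>\<alpha>. g \<alpha> - h \<alpha>"]
  by (intro infsumI) (simp add: cinner_diff_right diff_divide_distrib)

lemma hm_inner_commute: "ip f g = cnj (ip g f)"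
  unfolding hm_inner_def infsum_cnj[symmetric]
  by (intro infsum_cong) (subst cinner_commute, simp)

lemma hm_inner_diff_left:
  assumes "f \<in> \<H>" "g \<in> \<H>" "h \<in> \<H>"
  shows "ip (\<lambda>\<alpha>. g \<alpha> - h \<alpha>) f = ip g f - ip h f"
  using hm_inner_diff_right[OF assms] by (subst (1 2 3) hm_inner_commute) simp

lemma hm_inner_zero_right: "ip f (\<lambda>_. 0) = 0"
  by (simp add: hm_inner_def)

lemma hm_inner_sum_right:
  assumes "f \<in> \<H>" "\<And>i. i \<in> S \<Longrightarrow> F i \<in> \<H>"
  shows "ip f (\<lambda>\<alpha>. \<Sum>i\<in>S. F i \<alpha>) = (\<Sum>i\<in>S. ip f (F i))"
  using assms
  by (induction S rule: infinite_finite_induct) (auto simp: hm_inner_zero_right hm_inner_add_right Hm_sum)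

lemma hm_inner_self_has_sum:
  assumes "f \<in> \<H>"
  shows "((\<lambda>\<alpha>. (norm (f \<alpha>))\<^sup>2 / \<rho> \<alpha>) has_sum Re (ip f f)) (mindex n)"
proof -
  have "Re (cinner (f \<alpha>) (f \<alpha>) / complex_of_real (\<rho> \<alpha>)) = (norm (f \<alpha>))\<^sup>2 / \<rho> \<alpha>" for \<alpha>
    by (simp add: cinner_self_norm flip: of_real_divide of_real_power)
  then show ?thesis using has_sum_Re[OF hm_inner_has_sum[OF assms assms]] by (simp only:)
qed

lemma hm_inner_self_nonneg: "f \<in> \<H> \<Longrightarrow> 0 \<le> Re (ip f f)"
  by (rule has_sum_nonneg[OF hm_inner_self_has_sum]) (auto simp: less_imp_le[OF rhoM_pos])

lemma hm_inner_self_zero: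
  assumes f: "f \<in> \<H>" and "ip f f = 0"
  shows "f \<alpha> = 0"
proof (cases "\<alpha> \<in> mindex n")
  case True
  have "(norm (f \<alpha>))\<^sup>2 / \<rho> \<alpha> = 0"
    by (rule nonneg_has_sum_le_0D[OF hm_inner_self_has_sum[OF f] _ _ True])
      (use assms in \<open>auto simp: less_imp_le[OF rhoM_pos]\<close>)
  then show ?thesis using rhoM_pos[of n m \<alpha>] by simp
qed (use f in \<open>simp add: HmD\<close>)

lemma hm_inner_bound:
  assumes f: "f \<in> \<H>" and g: "g \<in> \<H>" and s: "s > 0"
  shows "2 * cmod (ip f g) \<le> s * Re (ip f f) + Re (ip g g) / s"
proof -
  have "cmod (ip f g) \<le> (\<Sum>\<^sub>\<infinity>\<alpha>\<in>mindex n. norm (cinner (f \<alpha>) (g \<alpha>) / complex_of_real (\<rho> \<alpha>)))"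
    unfolding hm_inner_def by (rule norm_infsum_bound[OF hm_inner_norm_summable[OF f g]])
  moreover have "2 * (\<Sum>\<^sub>\<infinity>\<alpha>\<in>mindex n. norm (cinner (f \<alpha>) (g \<alpha>) / complex_of_real (\<rho> \<alpha>)))
      \<le> s * Re (ip f f) + Re (ip g g) / s"
  proof (rule has_sum_mono)
    show "((\<lambda>\<alpha>. 2 * norm (cinner (f \<alpha>) (g \<alpha>) / complex_of_real (\<rho> \<alpha>))) has_sum
        2 * (\<Sum>\<^sub>\<infinity>\<alpha>\<in>mindex n. norm (cinner (f \<alpha>) (g \<alpha>) / complex_of_real (\<rho> \<alpha>)))) (mindex n)"
      by (intro has_sum_cmult_right has_sum_infsum hm_inner_norm_summable f g)
    show "((\<lambda>\<alpha>. s * ((norm (f \<alpha>))\<^sup>2 / \<rho> \<alpha>) + (norm (g \<alpha>))\<^sup>2 / \<rho> \<alpha> / s) has_sum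
        (s * Re (ip f f) + Re (ip g g) / s)) (mindex n)"
      by (intro has_sum_add has_sum_cmult_right has_sum_divide_const hm_inner_self_has_sum f g)
    fix \<alpha>
    define a b where "a = norm (f \<alpha>)" and "b = norm (g \<alpha>)"
    have "0 \<le> (s * a - b)\<^sup>2 / s" using s by simp
    also have "\<dots> = s * a\<^sup>2 - 2 * (a * b) + b\<^sup>2 / s"
      using s by (simp add: power2_eq_square field_simps)
    finally have "2 * cmod (cinner (f \<alpha>) (g \<alpha>)) \<le> s * a\<^sup>2 + b\<^sup>2 / s"
      using cmod_cinner_le[of "f \<alpha>" "g \<alpha>"] unfolding a_def b_def by argo
    from divide_right_mono[OF this less_imp_le[OF rhoM_pos[of n m \<alpha>]]]
    show "2 * norm (cinner (f \<alpha>) (g \<alpha>) / complex_of_real (\<rho> \<alpha>)) \<le>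
        s * ((norm (f \<alpha>))\<^sup>2 / \<rho> \<alpha>) + (norm (g \<alpha>))\<^sup>2 / \<rho> \<alpha> / s"
      using rhoM_pos[of n m \<alpha>] by (simp add: norm_divide add_divide_distrib a_def b_def mult.commute)
  qed
  ultimately show ?thesis by argo
qed

lemma shift_weight:
  assumes "i < n"
  shows "1 / \<rho> (\<alpha>(i := Suc (\<alpha> i))) = real (Suc (\<alpha> i)) / real (m + mabs n \<alpha>) / \<rho> \<alpha>"
  using rhoM_Suc[OF assms m, of \<alpha>] rhoM_pos[of n m "\<alpha>(i := Suc (\<alpha> i))"] rhoM_pos[of n m \<alpha>] m
  by (simp add: field_simps del: of_nat_Suc of_nat_add)

lemma shift_factor_le:
  assumes "i < n"
  shows "real (Suc (\<alpha> i)) / real (m + mabs n \<alpha>) \<le> 1"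
proof -
  have "\<alpha> i \<le> mabs n \<alpha>" unfolding mabs_def using assms by (intro member_le_sum) auto
  then show ?thesis using m by simp
qed

lemma Mz_Hm:
  assumes i: "i < n" and f: "f \<in> \<H>"
  shows "Mz n i f \<in> \<H>"
proof (rule HmI)
  have "(\<lambda>\<alpha>. (norm (f \<alpha>))\<^sup>2 / \<rho> (\<alpha>(i := Suc (\<alpha> i)))) summable_on mindex n"
  proof (rule summable_on_comparison_test[OF HmD(3)[OF f]])
    fix \<alpha>
    have "(norm (f \<alpha>))\<^sup>2 / \<rho> (\<alpha>(i := Suc (\<alpha> i))) =
        real (Suc (\<alpha> i)) / real (m + mabs n \<alpha>) * ((norm (f \<alpha>))\<^sup>2 / \<rho> \<alpha>)"
      using shift_weight[OF i, of \<alpha>] by (simp add: divide_inverse mult_ac)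
    also have "\<dots> \<le> 1 * ((norm (f \<alpha>))\<^sup>2 / \<rho> \<alpha>)"
      by (intro mult_right_mono shift_factor_le i) (simp add: less_imp_le[OF rhoM_pos])
    finally show "(norm (f \<alpha>))\<^sup>2 / \<rho> (\<alpha>(i := Suc (\<alpha> i))) \<le> (norm (f \<alpha>))\<^sup>2 / \<rho> \<alpha>" by simp
  qed (simp add: less_imp_le[OF rhoM_pos])
  then obtain s where "((\<lambda>\<alpha>. (norm (f \<alpha>))\<^sup>2 / \<rho> (\<alpha>(i := Suc (\<alpha> i)))) has_sum s) (mindex n)"
    by (auto simp: summable_on_def)
  then have "((\<lambda>\<beta>. if 1 \<le> \<beta> i then (norm (f (\<beta>(i := \<beta> i - 1))))\<^sup>2 / \<rho> \<beta> else 0) has_sum s) (mindex n)"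
    by (subst has_sum_mindex_shift[OF i]) simp
  also have "?this \<longleftrightarrow> ((\<lambda>\<beta>. (norm (Mz n i f \<beta>))\<^sup>2 / \<rho> \<beta>) has_sum s) (mindex n)"
    by (rule has_sum_cong) (simp add: Mz_def)
  finally show "(\<lambda>\<beta>. (norm (Mz n i f \<beta>))\<^sup>2 / \<rho> \<beta>) summable_on mindex n"
    by (rule has_sum_imp_summable)
qed (use f in \<open>auto simp: Mz_def HmD D_zero\<close>)

lemma Mz_adj_Hm:
  assumes i: "i < n" and g: "g \<in> \<H>"
  shows "Mz_adj n m i g \<in> \<H>"
proof (rule HmI)
  have "(\<lambda>\<beta>. if 1 \<le> \<beta> i then (norm (g \<beta>))\<^sup>2 / \<rho> \<beta> else 0) summable_on mindex n"
    by (rule summable_on_comparison_test[OF HmD(3)[OF g]]) (auto simp: less_imp_le[OF rhoM_pos])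
  then obtain s where "((\<lambda>\<beta>. if 1 \<le> \<beta> i then (norm (g \<beta>))\<^sup>2 / \<rho> \<beta> else 0) has_sum s) (mindex n)"
    by (auto simp: summable_on_def)
  then have "(\<lambda>\<alpha>. (norm (g (\<alpha>(i := Suc (\<alpha> i)))))\<^sup>2 / \<rho> (\<alpha>(i := Suc (\<alpha> i)))) summable_on mindex n"
    unfolding has_sum_mindex_shift[OF i] by (rule has_sum_imp_summable)
  then show "(\<lambda>\<alpha>. (norm (Mz_adj n m i g \<alpha>))\<^sup>2 / \<rho> \<alpha>) summable_on mindex n"
  proof (rule summable_on_comparison_test)
    fix \<alpha> assume \<alpha>: "\<alpha> \<in> mindex n"
    define w where "w = real (Suc (\<alpha> i)) / real (m + mabs n \<alpha>)"
    let ?g = "g (\<alpha>(i := Suc (\<alpha> i)))"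
    have "Mz_adj n m i g \<alpha> = w *\<^sub>R ?g" using \<alpha> by (simp only: Mz_adj_def w_def if_True)
    then have "(norm (Mz_adj n m i g \<alpha>))\<^sup>2 / \<rho> \<alpha> = w * (w / \<rho> \<alpha> * (norm ?g)\<^sup>2)"
      by (simp add: power_mult_distrib power2_eq_square[of w])
    also have "\<dots> \<le> 1 * (w / \<rho> \<alpha> * (norm ?g)\<^sup>2)"
      unfolding w_def by (intro mult_right_mono shift_factor_le i) (auto simp: less_imp_le[OF rhoM_pos])
    also have "w / \<rho> \<alpha> = 1 / \<rho> (\<alpha>(i := Suc (\<alpha> i)))"
      unfolding w_def by (rule shift_weight[OF i, symmetric])
    finally show "(norm (Mz_adj n m i g \<alpha>))\<^sup>2 / \<rho> \<alpha> \<le> (norm ?g)\<^sup>2 / \<rho> (\<alpha>(i := Suc (\<alpha> i)))"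
      by (simp only: mult_1_left times_divide_eq_left)
  qed (simp add: less_imp_le[OF rhoM_pos])
qed (use g in \<open>auto simp: Mz_adj_def HmD D_scaleR\<close>)

lemma hm_inner_Mz:
  assumes i: "i < n" and f: "f \<in> \<H>" and g: "g \<in> \<H>"
  shows "ip (Mz n i f) g = ip f (Mz_adj n m i g)"
proof -
  have "((\<lambda>\<beta>. cinner (Mz n i f \<beta>) (g \<beta>) / complex_of_real (\<rho> \<beta>)) has_sum ip (Mz n i f) g) (mindex n)"
    by (intro hm_inner_has_sum Mz_Hm i f g)
  also have "?this \<longleftrightarrow> ((\<lambda>\<beta>. if 1 \<le> \<beta> i then cinner (f (\<beta>(i := \<beta> i - 1))) (g \<beta>) / complex_of_real (\<rho> \<beta>) else 0)
      has_sum ip (Mz n i f) g) (mindex n)"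
    by (rule has_sum_cong) (simp add: Mz_def)
  also have "\<dots> \<longleftrightarrow> ((\<lambda>\<alpha>. cinner (f \<alpha>) (g (\<alpha>(i := Suc (\<alpha> i)))) / complex_of_real (\<rho> (\<alpha>(i := Suc (\<alpha> i)))))
      has_sum ip (Mz n i f) g) (mindex n)"
    by (subst has_sum_mindex_shift[OF i]) simp
  also have "\<dots> \<longleftrightarrow> ((\<lambda>\<alpha>. cinner (f \<alpha>) (Mz_adj n m i g \<alpha>) / complex_of_real (\<rho> \<alpha>)) has_sum ip (Mz n i f) g) (mindex n)"
  proof (rule has_sum_cong)
    fix \<alpha> assume \<alpha>: "\<alpha> \<in> mindex n"
    let ?c = "cinner (f \<alpha>) (g (\<alpha>(i := Suc (\<alpha> i))))"
    have "?c / complex_of_real (\<rho> (\<alpha>(i := Suc (\<alpha> i)))) = complex_of_real (1 / \<rho> (\<alpha>(i := Suc (\<alpha> i)))) * ?c"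
      by simp
    also have "\<dots> = cinner (f \<alpha>) (Mz_adj n m i g \<alpha>) / complex_of_real (\<rho> \<alpha>)"
      unfolding shift_weight[OF i] using \<alpha>
      by (simp add: Mz_adj_def cinner_scaleR_right del: of_nat_Suc of_nat_add)
    finally show "?c / complex_of_real (\<rho> (\<alpha>(i := Suc (\<alpha> i)))) =
        cinner (f \<alpha>) (Mz_adj n m i g \<alpha>) / complex_of_real (\<rho> \<alpha>)" .
  qed
  finally show ?thesis
    using hm_inner_has_sum[OF f Mz_adj_Hm[OF i g]] has_sum_unique by blast
qed

lemma Mz_star_eq:
  assumes g: "g \<in> \<H>"
  shows "Mz_star n m D g = (\<lambda>i. if i < n then Mz_adj n m i g else (\<lambda>_. 0))"
proof -
  have "adj_on \<H> ip (Mz n i) g = Mz_adj n m i g" if i: "i < n" for i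
    unfolding adj_on_def
  proof (rule the_equality)
    show "Mz_adj n m i g \<in> \<H> \<and> (\<forall>f\<in>\<H>. ip (Mz n i f) g = ip f (Mz_adj n m i g))"
      using Mz_adj_Hm[OF i g] hm_inner_Mz[OF i _ g] by blast
    fix h assume h: "h \<in> \<H> \<and> (\<forall>f\<in>\<H>. ip (Mz n i f) g = ip f h)"
    define d where "d = (\<lambda>\<alpha>. h \<alpha> - Mz_adj n m i g \<alpha>)"
    have d: "d \<in> \<H>" unfolding d_def using h Mz_adj_Hm[OF i g] by (intro Hm_diff) auto
    have "ip d d = ip d h - ip d (Mz_adj n m i g)"
      using hm_inner_diff_right[OF d, of h "Mz_adj n m i g"] h Mz_adj_Hm[OF i g] by (simp add: d_def)
    also have "\<dots> = 0" using h d hm_inner_Mz[OF i d g] by simp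
    finally have "d \<alpha> = 0" for \<alpha> using hm_inner_self_zero[OF d] by blast
    then show "h = Mz_adj n m i g" by (simp add: d_def fun_eq_iff)
  qed
  then show ?thesis by (auto simp: Mz_star_def)
qed

lemma Mz_row_Mz_star:
  assumes g: "g \<in> \<H>"
  shows "Mz_row n (Mz_star n m D g) \<alpha> = (real (mabs n \<alpha>) / real (m + mabs n \<alpha> - 1)) *\<^sub>R g \<alpha>"
proof (cases "\<alpha> \<in> mindex n")
  case True
  have "Mz n i (Mz_adj n m i g) \<alpha> = (real (\<alpha> i) / real (m + mabs n \<alpha> - 1)) *\<^sub>R g \<alpha>" if i: "i < n" for i
  proof (cases "1 \<le> \<alpha> i")
    case a: True
    let ?\<beta> = "\<alpha>(i := \<alpha> i - 1)"
    have eq: "?\<beta>(i := Suc (?\<beta> i)) = \<alpha>" using a by auto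
    have "mabs n \<alpha> = Suc (mabs n ?\<beta>)" using mabs_Suc[OF i, of ?\<beta>] unfolding eq .
    then have "m + mabs n \<alpha> - 1 = m + mabs n ?\<beta>" by simp
    then show ?thesis
      using a True mindex_upd[OF True i, of "\<alpha> i - 1"] eq by (simp add: Mz_def Mz_adj_def)
  qed (simp add: Mz_def)
  then have "Mz_row n (Mz_star n m D g) \<alpha> = (\<Sum>i<n. real (\<alpha> i) / real (m + mabs n \<alpha> - 1)) *\<^sub>R g \<alpha>"
    by (simp add: Mz_row_def Mz_star_eq[OF g] scaleR_sum_left)
  also have "(\<Sum>i<n. real (\<alpha> i) / real (m + mabs n \<alpha> - 1)) = real (mabs n \<alpha>) / real (m + mabs n \<alpha> - 1)"
    by (simp only: sum_divide_distrib[symmetric] of_nat_sum mabs_def)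
  finally show ?thesis .
next
  case False
  then show ?thesis using g by (simp add: Mz_row_def Mz_def HmD)
qed

lemma hm_inner_Mz_right:
  assumes "i < n" "f \<in> \<H>" "g \<in> \<H>"
  shows "ip f (Mz n i g) = ip (Mz_adj n m i f) g"
  by (subst (1 2) hm_inner_commute) (simp add: hm_inner_Mz[OF assms(1,3,2)])

lemma Mz_row_Hm: "(\<And>i. i < n \<Longrightarrow> g i \<in> \<H>) \<Longrightarrow> Mz_row n g \<in> \<H>"
  unfolding Mz_row_def by (intro Hm_sum Mz_Hm) auto

lemma orthogonal_hm_closure:
  assumes f: "f \<in> \<H>" and S: "S \<subseteq> \<H>" and orth: "\<And>g. g \<in> S \<Longrightarrow> ip f g = 0" and h: "h \<in> hm_closure n m D S"
  shows "ip f h = 0"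
proof -
  have hH: "h \<in> \<H>" using h by (simp add: hm_closure_def)
  have le: "2 * cmod (ip f h) \<le> s * (Re (ip f f) + 1)" if s: "s > 0" for s
  proof -
    obtain g where g: "g \<in> S" "hm_norm n m (\<lambda>\<alpha>. h \<alpha> - g \<alpha>) < s"
      using h s by (auto simp: hm_closure_def)
    define d where "d = (\<lambda>\<alpha>. h \<alpha> - g \<alpha>)"
    have gH: "g \<in> \<H>" using g S by blast
    have d: "d \<in> \<H>" unfolding d_def by (intro Hm_diff hH gH)
    have "sqrt (Re (ip d d)) < s" using g(2) by (simp add: d_def hm_norm_def)
    then have "Re (ip d d) < s\<^sup>2"
      using s by (metis hm_inner_self_nonneg[OF d] real_less_lsqrt real_sqrt_less_iff real_sqrt_pow2_iff real_sqrt_abs abs_of_pos)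
    then have "Re (ip d d) / s \<le> s" using s by (simp add: power2_eq_square field_simps)
    moreover have "ip f d = ip f h" using hm_inner_diff_right[OF f hH gH] orth[OF g(1)] by (simp add: d_def)
    ultimately show ?thesis using hm_inner_bound[OF f d s] by (simp add: algebra_simps)
  qed
  show ?thesis
  proof (rule ccontr)
    assume "ip f h \<noteq> 0"
    then have p: "cmod (ip f h) > 0" by simp
    define b where "b = Re (ip f f) + 1"
    have b: "b > 0" using hm_inner_self_nonneg[OF f] by (simp add: b_def)
    have "2 * cmod (ip f h) \<le> cmod (ip f h) / b * b" using le[of "cmod (ip f h) / b"] p b by (simp add: b_def)
    then show False using p b by simp
  qed
qed

lemma Mz_adj_cong:
  assumes "i < n" "\<And>\<alpha>. \<alpha> \<in> mindex n \<Longrightarrow> \<alpha> \<noteq> (\<lambda>_. 0) \<Longrightarrow> f \<alpha> = g \<alpha>"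
  shows "Mz_adj n m i f = Mz_adj n m i g"
proof
  fix \<alpha>
  have "f (\<alpha>(i := Suc (\<alpha> i))) = g (\<alpha>(i := Suc (\<alpha> i)))" if "\<alpha> \<in> mindex n"
    using that assms by (intro assms(2) mindex_upd) (auto simp: fun_eq_iff)
  then show "Mz_adj n m i f \<alpha> = Mz_adj n m i g \<alpha>" by (simp add: Mz_adj_def)
qed

lemma Mz_star_eq_iff:
  assumes f: "f \<in> \<H>" and g: "g \<in> \<H>"
  shows "Mz_star n m D f = Mz_star n m D g \<longleftrightarrow> (\<forall>\<alpha>\<in>mindex n. \<alpha> \<noteq> (\<lambda>_. 0) \<longrightarrow> f \<alpha> = g \<alpha>)"
proof
  assume eq: "Mz_star n m D f = Mz_star n m D g"
  show "\<forall>\<alpha>\<in>mindex n. \<alpha> \<noteq> (\<lambda>_. 0) \<longrightarrow> f \<alpha> = g \<alpha>"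
  proof (intro ballI impI)
    fix \<alpha> assume \<alpha>: "\<alpha> \<in> mindex n" and "\<alpha> \<noteq> (\<lambda>_. 0)"
    then obtain i where "\<alpha> i \<noteq> 0" by (auto simp: fun_eq_iff)
    then have i: "i < n" "1 \<le> \<alpha> i" using \<alpha> unfolding mindex_def by (auto simp: not_less[symmetric])
    let ?\<beta> = "\<alpha>(i := \<alpha> i - 1)"
    have \<beta>: "?\<beta> \<in> mindex n" by (rule mindex_upd[OF \<alpha> i(1)])
    have s: "?\<beta>(i := Suc (?\<beta> i)) = \<alpha>" using i by auto
    have "Mz_adj n m i f = Mz_adj n m i g"
      using fun_cong[OF eq, of i] i by (simp add: Mz_star_eq[OF f] Mz_star_eq[OF g])
    from fun_cong[OF this, of ?\<beta>]
    have "(real (Suc (?\<beta> i)) / real (m + mabs n ?\<beta>)) *\<^sub>R f \<alpha> = (real (Suc (?\<beta> i)) / real (m + mabs n ?\<beta>)) *\<^sub>R g \<alpha>"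
      unfolding Mz_adj_def s using \<beta> by argo
    then show "f \<alpha> = g \<alpha>" using m by (simp del: of_nat_Suc of_nat_add)
  qed
next
  assume "\<forall>\<alpha>\<in>mindex n. \<alpha> \<noteq> (\<lambda>_. 0) \<longrightarrow> f \<alpha> = g \<alpha>"
  then show "Mz_star n m D f = Mz_star n m D g"
    using Mz_adj_cong[of _ f g] by (auto simp: Mz_star_eq[OF f] Mz_star_eq[OF g])
qed

text \<open>\<open>M\<^sub>z M\<^sub>z\<^sup>*\<close> acts on the coefficient of \<open>z\<^sup>\<alpha>\<close> as multiplication by \<open>|\<alpha>| / (m + |\<alpha>| - 1)\<close>,
  so that \<open>M\<^sub>z (M\<^sub>z\<^sup>* M\<^sub>z)\<inverse> M\<^sub>z\<^sup>*\<close> is the projection onto the functions vanishing at \<open>0\<close>.\<close>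

lemma Mz_row_gram_inv:
  assumes g: "g \<in> \<H>"
  shows "Mz_row n (gram_inv n m D (Mz_star n m D g)) = (\<lambda>\<alpha>. g \<alpha> - const_fn (g (\<lambda>_. 0)) \<alpha>)"
proof -
  define w where "w \<alpha> = real (m + mabs n \<alpha> - 1) / real (mabs n \<alpha>)" for \<alpha>
  define h where "h \<alpha> = w \<alpha> *\<^sub>R g \<alpha>" for \<alpha>
  have w_bound: "\<bar>w \<alpha>\<bar> \<le> real m" for \<alpha>
  proof (cases "mabs n \<alpha>")
    case (Suc k)
    have "m + k \<le> m * Suc k" using m by (cases m) auto
    then have "real (m + k) \<le> real m * real (Suc k)" by (metis of_nat_le_iff of_nat_mult)
    then show ?thesis using Suc by (simp add: w_def divide_le_eq del: of_nat_Suc of_nat_add)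
  qed (simp add: w_def)
  have h: "h \<in> \<H>" unfolding h_def by (rule Hm_scaleR_bounded[OF g w_bound])
  have inv: "(real (mabs n \<alpha>) / real (m + mabs n \<alpha> - 1)) *\<^sub>R h \<alpha> = g \<alpha>"
    if nz: "\<alpha> \<in> mindex n" "\<alpha> \<noteq> (\<lambda>_. 0)" for \<alpha>
  proof -
    obtain k where "mabs n \<alpha> = Suc k" using nz mabs_eq_0_iff[of \<alpha> n] by (cases "mabs n \<alpha>") auto
    then show ?thesis using m by (simp add: h_def w_def del: of_nat_Suc of_nat_add)
  qed
  have row_h: "Mz_row n (Mz_star n m D h) = (\<lambda>\<alpha>. g \<alpha> - const_fn (g (\<lambda>_. 0)) \<alpha>)"
  proof
    fix \<alpha>
    show "Mz_row n (Mz_star n m D h) \<alpha> = g \<alpha> - const_fn (g (\<lambda>_. 0)) \<alpha>"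
    proof (cases "\<alpha> = (\<lambda>_. 0) \<or> \<alpha> \<notin> mindex n")
      case True
      moreover have "h \<alpha> = 0 \<and> g \<alpha> = 0 \<and> \<alpha> \<noteq> (\<lambda>_. 0)" if "\<alpha> \<notin> mindex n"
        using HmD(1)[OF g that] HmD(1)[OF h that] that mindex_zero[of n] by metis
      ultimately show ?thesis by (auto simp: Mz_row_Mz_star[OF h])
    qed (use inv in \<open>auto simp: Mz_row_Mz_star[OF h]\<close>)
  qed
  have row_Hm: "Mz_row n (Mz_star n m D k) \<in> \<H>" if "k \<in> \<H>" for k
    unfolding Mz_row_def using that by (intro Hm_sum Mz_Hm) (auto simp: Mz_star_eq Mz_adj_Hm)
  have "gram_inv n m D (Mz_star n m D g) = Mz_star n m D h"
    unfolding gram_inv_def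
  proof (rule the_equality)
    have "Mz_star n m D (Mz_row n (Mz_star n m D h)) = Mz_star n m D g"
      unfolding Mz_star_eq_iff[OF row_Hm[OF h] g] by (simp add: row_h)
    then show "Mz_star n m D h \<in> Mz_star n m D ` \<H> \<and> Mz_star n m D (Mz_row n (Mz_star n m D h)) = Mz_star n m D g"
      using h by blast
    fix u assume u: "u \<in> Mz_star n m D ` \<H> \<and> Mz_star n m D (Mz_row n u) = Mz_star n m D g"
    then obtain k where k: "k \<in> \<H>" "u = Mz_star n m D k" by blast
    have "k \<alpha> = h \<alpha>" if \<alpha>: "\<alpha> \<in> mindex n" "\<alpha> \<noteq> (\<lambda>_. 0)" for \<alpha>
    proof -
      have "(real (mabs n \<alpha>) / real (m + mabs n \<alpha> - 1)) *\<^sub>R k \<alpha> = g \<alpha>"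
        using u \<alpha> Mz_star_eq_iff[OF row_Hm[OF k(1)] g] by (simp add: k Mz_row_Mz_star)
      with inv[OF \<alpha>] have "(real (mabs n \<alpha>) / real (m + mabs n \<alpha> - 1)) *\<^sub>R k \<alpha> =
          (real (mabs n \<alpha>) / real (m + mabs n \<alpha> - 1)) *\<^sub>R h \<alpha>" by simp
      moreover have "mabs n \<alpha> > 0" using \<alpha> mabs_eq_0_iff[of \<alpha> n] by simp
      then have "real (mabs n \<alpha>) / real (m + mabs n \<alpha> - 1) \<noteq> 0" using m by simp
      ultimately show ?thesis using scaleR_cancel_left by blast
    qed
    then show "u = Mz_star n m D h" using Mz_star_eq_iff[OF k(1) h] k by blast
  qed
  then show ?thesis by (simp add: row_h)
qed

end

section \<open>The wandering subspace\<close>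

context pure_hypercontraction
begin

lemma C_in_defectD: "C x \<in> \<D>"
  unfolding defectD_def by (rule subsetD[OF closure_subset]) simp

sublocale Hm_space n m \<D>
proof
  show "1 \<le> m" by (rule m)
  show "0 \<in> \<D>" using C_in_defectD[of 0] by (simp add: bounded_clinear_opD[OF C_bounded])
  show "x + y \<in> \<D>" if "x \<in> \<D>" "y \<in> \<D>" for x y
  proof -
    from that obtain u v where u: "\<forall>k. u k \<in> range C" "u \<longlonglongrightarrow> x" and v: "\<forall>k. v k \<in> range C" "v \<longlonglongrightarrow> y"
      unfolding defectD_def closure_sequential by (elim exE conjE)
    have "\<forall>k. u k + v k \<in> range C"
    proof
      fix k
      obtain a b where "u k = C a" "v k = C b" using u(1) v(1) by (metis imageE)
      then have "u k + v k = C (a + b)" by (simp add: bounded_clinear_opD[OF C_bounded])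
      then show "u k + v k \<in> range C" by simp
    qed
    then show ?thesis
      unfolding defectD_def closure_sequential using tendsto_add[OF u(2) v(2)]
      by (intro exI[of _ "\<lambda>k. u k + v k"] conjI)
  qed
  show "scaleC c x \<in> \<D>" if "x \<in> \<D>" for c x
  proof -
    from that obtain u where u: "\<forall>k. u k \<in> range C" "u \<longlonglongrightarrow> x"
      unfolding defectD_def closure_sequential by (elim exE conjE)
    have "bounded_linear (scaleC c :: 'h \<Rightarrow> 'h)"
      by (rule bounded_linear_intro[of _ "cmod c"]) (auto simp: scaleC_add_right scaleC_scaleR norm_scaleC mult.commute)
    then have "(\<lambda>k. scaleC c (u k)) \<longlonglongrightarrow> scaleC c x" using u(2) by (rule bounded_linear.tendsto)
    moreover have "\<forall>k. scaleC c (u k) \<in> range C"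
    proof
      fix k
      obtain a where "u k = C a" using u(1) by (metis imageE)
      then have "scaleC c (u k) = C (scaleC c a)" by (simp add: bounded_clinear_opD[OF C_bounded])
      then show "scaleC c (u k) \<in> range C" by simp
    qed
    ultimately show ?thesis
      unfolding defectD_def closure_sequential by (intro exI[of _ "\<lambda>k. scaleC c (u k)"] conjI)
  qed
qed

lemma j_Hm: "j x \<in> \<H>"
proof (rule HmI)
  have eq: "(norm (j x \<alpha>))\<^sup>2 / \<rho> \<alpha> = Re (of_real (\<rho> \<alpha>) * cinner (C (adjTpow \<alpha> x)) (C (adjTpow \<alpha> x)))"
    if "\<alpha> \<in> mindex n" for \<alpha>
    using that rhoM_pos[of n m \<alpha>]
    by (simp add: jmap_def power_mult_distrib norm_square_Re_cinner power2_eq_square[of "\<rho> \<alpha>"])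
  show "(\<lambda>\<alpha>. (norm (j x \<alpha>))\<^sup>2 / \<rho> \<alpha>) summable_on mindex n"
    by (rule iffD2[OF summable_on_cong[OF eq] has_sum_imp_summable[OF has_sum_Re[OF cinner_has_sum[of x x]]]])
qed (auto simp: jmap_def intro: D_scaleR C_in_defectD)

lemma hm_inner_j_has_sum:
  assumes "f \<in> \<H>"
  shows "((\<lambda>\<alpha>. cinner (f \<alpha>) (C (adjTpow \<alpha> y))) has_sum ip f (j y)) (mindex n)"
proof -
  have eq: "cinner (f \<alpha>) (j y \<alpha>) / complex_of_real (\<rho> \<alpha>) = cinner (f \<alpha>) (C (adjTpow \<alpha> y))"
    if "\<alpha> \<in> mindex n" for \<alpha>
    using that rhoM_pos[of n m \<alpha>] by (simp add: jmap_def cinner_scaleR_right)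
  show ?thesis
    by (rule iffD1[OF has_sum_cong[OF eq] hm_inner_has_sum[OF assms j_Hm]])
qed

lemma hm_inner_j_j: "ip (j x) (j y) = cinner x y"
proof -
  have "((\<lambda>\<alpha>. cinner (j x \<alpha>) (C (adjTpow \<alpha> y))) has_sum cinner x y) (mindex n) \<longleftrightarrow>
      ((\<lambda>\<alpha>. of_real (rhoM n m \<alpha>) * cinner (C (adjTpow \<alpha> x)) (C (adjTpow \<alpha> y))) has_sum cinner x y) (mindex n)"
    by (rule has_sum_cong) (simp add: jmap_def cinner_scaleR_left)
  then show ?thesis
    using cinner_has_sum[of x y] hm_inner_j_has_sum[OF j_Hm[of x], of y] has_sum_unique by blast
qed

lemma j_adjoint_exists:
  assumes g: "g \<in> \<H>"
  shows "\<exists>v. \<forall>x. ip g (j x) = cinner v x"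
proof (rule riesz_representation)
  note jy = hm_inner_j_has_sum[OF g]
  show "ip g (j (x + y)) = ip g (j x) + ip g (j y)" for x y
    using has_sum_add[OF jy[of x] jy[of y]] jy[of "x + y"]
    by (auto simp: bounded_clinear_opD[OF C_bounded] bounded_clinear_opD[OF adjTpow_bounded]
        cinner_add_right dest: has_sum_unique)
  show scale: "ip g (j (scaleC c x)) = c * ip g (j x)" for c x
    using has_sum_cmult_right[OF jy[of x], of c] jy[of "scaleC c x"]
    by (auto simp: bounded_clinear_opD[OF C_bounded] bounded_clinear_opD[OF adjTpow_bounded]
        cinner_scaleC_right dest: has_sum_unique)
  show "cmod (ip g (j x)) \<le> (Re (ip g g) + 1) * norm x" for x
  proof (cases "x = 0")
    case True
    then show ?thesis using scale[of 0 x] scaleC_of_real[of 0 x] by simp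
  next
    case False
    then have "2 * cmod (ip g (j x)) \<le> norm x * Re (ip g g) + (norm x)\<^sup>2 / norm x"
      using hm_inner_bound[OF g j_Hm[of x], of "norm x"] by (simp add: hm_inner_j_j norm_square_Re_cinner)
    moreover have "(norm x)\<^sup>2 / norm x = norm x" using False by (simp add: power2_eq_square)
    moreover have "0 \<le> norm x * Re (ip g g)" using hm_inner_self_nonneg[OF g] by simp
    ultimately show ?thesis using norm_ge_zero[of x] unfolding distrib_right mult_1_left
      by (simp only: mult.commute[of _ "norm x"])
  qed
qed

lemma Msub_iff: "f \<in> Msub n m T \<longleftrightarrow> f \<in> \<H> \<and> (\<forall>x. ip f (j x) = 0)"
  by (auto simp: Msub_def hm_ominus_def)

lemma orthogonal_Msub_iff:
  assumes k: "k \<in> \<H>"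
  shows "(\<forall>g\<in>Msub n m T. ip k g = 0) \<longleftrightarrow> k \<in> range j"
proof
  assume orth: "\<forall>g\<in>Msub n m T. ip k g = 0"
  obtain v where v: "\<And>x. ip k (j x) = cinner v x" using j_adjoint_exists[OF k] by blast
  define d where "d = (\<lambda>\<alpha>. k \<alpha> - j v \<alpha>)"
  have d: "d \<in> \<H>" unfolding d_def by (intro Hm_diff k j_Hm)
  have dj: "ip d (j x) = 0" for x
    unfolding d_def by (simp add: hm_inner_diff_left[OF j_Hm k j_Hm] v hm_inner_j_j)
  then have "d \<in> Msub n m T" using d by (simp add: Msub_iff)
  then have "ip d k = 0" using orth hm_inner_commute[of d k] by simp
  then have "ip d d = 0" using hm_inner_diff_right[OF d k j_Hm[of v]] dj by (simp add: d_def)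
  then have "d \<alpha> = 0" for \<alpha> by (rule hm_inner_self_zero[OF d])
  then have "k = j v" by (simp add: d_def fun_eq_iff)
  then show "k \<in> range j" by blast
next
  assume "k \<in> range j"
  then obtain x where "k = j x" by blast
  then show "\<forall>g\<in>Msub n m T. ip k g = 0"
    using hm_inner_commute[of "j x"] by (auto simp: Msub_iff)
qed

lemma WM_iff:
  assumes f: "f \<in> \<H>"
  shows "f \<in> WM n m T \<longleftrightarrow> (\<forall>x. ip f (j x) = 0) \<and> (\<forall>i<n. Mz_adj n m i f \<in> range j)"
proof -
  let ?S = "{Mz_row n g | g. \<forall>i<n. g i \<in> Msub n m T}"
  have SH: "?S \<subseteq> \<H>" by (auto simp: Msub_iff intro!: Mz_row_Hm)
  have row: "ip f (Mz_row n g) = (\<Sum>i<n. ip (Mz_adj n m i f) (g i))" if "\<forall>i<n. g i \<in> Msub n m T" for g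
  proof -
    have "ip f (Mz_row n g) = (\<Sum>i<n. ip f (Mz n i (g i)))"
      unfolding Mz_row_def using that by (intro hm_inner_sum_right f) (auto simp: Msub_iff intro!: Mz_Hm)
    then show ?thesis using that by (simp add: hm_inner_Mz_right f Msub_iff)
  qed
  have "(\<forall>h\<in>hm_closure n m \<D> ?S. ip f h = 0) \<longleftrightarrow> (\<forall>i<n. \<forall>g\<in>Msub n m T. ip (Mz_adj n m i f) g = 0)"
  proof (intro iffI allI impI ballI)
    fix i g assume orth: "\<forall>h\<in>hm_closure n m \<D> ?S. ip f h = 0" and i: "i < n" and g: "g \<in> Msub n m T"
    define G where "G k = (if k = i then g else (\<lambda>_. 0))" for k
    have "(\<lambda>_. 0) \<in> Msub n m T" by (simp add: Msub_iff Hm_zero) (simp add: hm_inner_def)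
    then have G: "\<forall>k<n. G k \<in> Msub n m T" using g by (simp add: G_def)
    then have GS: "Mz_row n G \<in> ?S" by blast
    have "hm_norm n m (\<lambda>\<alpha>. h \<alpha> - h \<alpha>) = 0" for h :: "(nat \<Rightarrow> nat) \<Rightarrow> 'h"
      by (simp add: hm_norm_def hm_inner_def)
    then have "Mz_row n G \<in> hm_closure n m \<D> ?S"
      unfolding hm_closure_def using subsetD[OF SH GS] by (intro CollectI conjI allI impI bexI[OF _ GS]) auto
    then have "0 = (\<Sum>k<n. ip (Mz_adj n m k f) (G k))" using orth row[OF G] by simp
    also have "\<dots> = (\<Sum>k<n. if k = i then ip (Mz_adj n m i f) g else 0)"
      by (intro sum.cong) (auto simp: G_def hm_inner_zero_right)
    also have "\<dots> = ip (Mz_adj n m i f) g" using i by simp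
    finally show "ip (Mz_adj n m i f) g = 0" by simp
  next
    fix h assume orth: "\<forall>i<n. \<forall>g\<in>Msub n m T. ip (Mz_adj n m i f) g = 0" and h: "h \<in> hm_closure n m \<D> ?S"
    have "ip f k = 0" if "k \<in> ?S" for k
    proof -
      obtain g where g: "k = Mz_row n g" "\<forall>i<n. g i \<in> Msub n m T"
        using \<open>k \<in> ?S\<close> by blast
      show ?thesis unfolding g(1) row[OF g(2)] using orth g(2) by (intro sum.neutral) simp
    qed
    then show "ip f h = 0" using orthogonal_hm_closure[OF f SH _ h] by blast
  qed
  also have "\<dots> \<longleftrightarrow> (\<forall>i<n. Mz_adj n m i f \<in> range j)"
    using orthogonal_Msub_iff[OF Mz_adj_Hm[OF _ f]] by blast
  finally show ?thesis using f by (simp add: WM_def hm_ominus_def[of n m "Msub n m T"] Msub_iff)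
qed

lemma hm_inner_j_eq:
  assumes f: "f \<in> \<H>" and x: "\<And>i. i < n \<Longrightarrow> Mz_adj n m i f = j (x i)"
  shows "ip f (j y) = cinner (C (f (\<lambda>_. 0)) + (\<Sum>i<n. T i (\<Sum>k<m. DeltaT n T k (x i)))) y"
proof -
  define G where "G i \<alpha> = of_real (real (\<alpha> i) / real (mabs n \<alpha>)) * cinner (f \<alpha>) (C (adjTpow \<alpha> y))" for i \<alpha>
  have G: "((\<lambda>\<alpha>. if 1 \<le> \<alpha> i then G i \<alpha> else 0) has_sum cinner (T i (\<Sum>k<m. DeltaT n T k (x i))) y) (mindex n)"
    if i: "i < n" for i
  proof -
    have eq: "G i (\<alpha>(i := Suc (\<alpha> i))) = of_real (real (m + mabs n \<alpha>) / real (Suc (mabs n \<alpha>)) * rhoM n m \<alpha>) *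
        cinner (C (adjTpow \<alpha> (x i))) (C (adjTpow \<alpha> (adjH (T i) y)))" if \<alpha>: "\<alpha> \<in> mindex n" for \<alpha>
    proof -
      define f' where "f' = f (\<alpha>(i := Suc (\<alpha> i)))"
      have "(real (Suc (\<alpha> i)) / real (m + mabs n \<alpha>)) *\<^sub>R f' = \<rho> \<alpha> *\<^sub>R C (adjTpow \<alpha> (x i))"
        using fun_cong[OF x[OF i], of \<alpha>] \<alpha> by (simp only: Mz_adj_def jmap_def if_True f'_def)
      then have "real (m + mabs n \<alpha>) *\<^sub>R ((real (Suc (\<alpha> i)) / real (m + mabs n \<alpha>)) *\<^sub>R f') =
          real (m + mabs n \<alpha>) *\<^sub>R (\<rho> \<alpha> *\<^sub>R C (adjTpow \<alpha> (x i)))" by (simp only:)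
      then have *: "real (Suc (\<alpha> i)) *\<^sub>R f' = (real (m + mabs n \<alpha>) * \<rho> \<alpha>) *\<^sub>R C (adjTpow \<alpha> (x i))"
        using m by (simp del: of_nat_Suc of_nat_add)
      have "G i (\<alpha>(i := Suc (\<alpha> i))) = of_real (1 / real (Suc (mabs n \<alpha>))) *
          cinner (real (Suc (\<alpha> i)) *\<^sub>R f') (C (adjTpow \<alpha> (adjH (T i) y)))"
        unfolding G_def mabs_Suc[OF i] adjH_Tpow_upd[OF i] f'_def cinner_scaleR_left
        by (simp del: of_nat_Suc)
      also have "\<dots> = of_real (real (m + mabs n \<alpha>) / real (Suc (mabs n \<alpha>)) * rhoM n m \<alpha>) *
          cinner (C (adjTpow \<alpha> (x i))) (C (adjTpow \<alpha> (adjH (T i) y)))"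
        unfolding * cinner_scaleR_left by (simp del: of_nat_Suc of_nat_add)
      finally show ?thesis .
    qed
    have "((\<lambda>\<alpha>. G i (\<alpha>(i := Suc (\<alpha> i)))) has_sum cinner (x i) (\<Sum>k<m. DeltaT n T k (adjH (T i) y))) (mindex n)"
      by (rule iffD2[OF has_sum_cong[OF eq] sum_DeltaT_has_sum])
    moreover have "cinner (x i) (\<Sum>k<m. DeltaT n T k (adjH (T i) y)) = cinner (T i (\<Sum>k<m. DeltaT n T k (x i))) y"
      by (simp add: cinner_adjH_right[OF T_bounded[OF i]] cinner_sum_left cinner_sum_right DeltaT_selfadjoint)
    ultimately show ?thesis unfolding has_sum_mindex_shift[OF i] by (simp only:)
  qed
  have "((\<lambda>\<alpha>. cinner (const_fn (f (\<lambda>_. 0)) \<alpha>) (C y)) has_sum cinner (C (f (\<lambda>_. 0))) y) (mindex n)"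
    by (rule has_sum_finite_neutralI[of "{\<lambda>_. 0}"]) (auto simp: C_selfadjoint)
  then have hs: "((\<lambda>\<alpha>. cinner (const_fn (f (\<lambda>_. 0)) \<alpha>) (C y) + (\<Sum>i<n. if 1 \<le> \<alpha> i then G i \<alpha> else 0)) has_sum
      (cinner (C (f (\<lambda>_. 0))) y + (\<Sum>i<n. cinner (T i (\<Sum>k<m. DeltaT n T k (x i))) y))) (mindex n)"
    using G by (intro has_sum_add has_sum_sum) auto
  have eq: "cinner (const_fn (f (\<lambda>_. 0)) \<alpha>) (C y) + (\<Sum>i<n. if 1 \<le> \<alpha> i then G i \<alpha> else 0) =
      cinner (f \<alpha>) (C (adjTpow \<alpha> y))" if \<alpha>: "\<alpha> \<in> mindex n" for \<alpha>
  proof (cases "\<alpha> = (\<lambda>_. 0)")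
    case True
    then show ?thesis by (simp add: Tpow_zero adjH_id)
  next
    case False
    then have "mabs n \<alpha> \<noteq> 0" using \<alpha> by (simp add: mabs_eq_0_iff)
    have "(\<Sum>i<n. if 1 \<le> \<alpha> i then G i \<alpha> else 0) = (\<Sum>i<n. G i \<alpha>)"
      by (intro sum.cong) (auto simp: G_def not_le)
    also have "\<dots> = of_real ((\<Sum>i<n. real (\<alpha> i)) / real (mabs n \<alpha>)) * cinner (f \<alpha>) (C (adjTpow \<alpha> y))"
      unfolding G_def sum_distrib_right[symmetric] of_real_sum[symmetric] sum_divide_distrib[symmetric] ..
    also have "(\<Sum>i<n. real (\<alpha> i)) / real (mabs n \<alpha>) = 1"
      using \<open>mabs n \<alpha> \<noteq> 0\<close> by (simp add: mabs_def flip: of_nat_sum)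
    finally show ?thesis using False by simp
  qed
  have "((\<lambda>\<alpha>. cinner (f \<alpha>) (C (adjTpow \<alpha> y))) has_sum
      (cinner (C (f (\<lambda>_. 0))) y + (\<Sum>i<n. cinner (T i (\<Sum>k<m. DeltaT n T k (x i))) y))) (mindex n)"
    by (rule iffD1[OF has_sum_cong[OF eq] hs])
  from has_sum_unique[OF hm_inner_j_has_sum[OF f] this]
  show ?thesis by (simp only: cinner_add_left cinner_sum_left)
qed

lemma WM_representation_iff:
  assumes f: "f \<in> \<H>"
  defines "Y \<equiv> \<lambda>x i. if i < n then j (x i) else (\<lambda>_. 0)"
  shows "f \<in> WM n m T \<longleftrightarrow> (\<exists>x. Mz_star n m \<D> f = Y x \<and>
    C (f (\<lambda>_. 0)) + (\<Sum>i<n. T i (\<Sum>k<m. DeltaT n T k (x i))) = 0)"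
proof -
  have star: "Mz_star n m \<D> f = Y x \<longleftrightarrow> (\<forall>i<n. Mz_adj n m i f = j (x i))" for x
    unfolding Mz_star_eq[OF f] Y_def by (auto simp: fun_eq_iff)
  have ex: "(\<forall>i<n. Mz_adj n m i f \<in> range j) \<longleftrightarrow> (\<exists>x. \<forall>i<n. Mz_adj n m i f = j (x i))"
    unfolding image_iff by (metis UNIV_I)
  have eqv: "(\<forall>y. ip f (j y) = 0) \<longleftrightarrow> C (f (\<lambda>_. 0)) + (\<Sum>i<n. T i (\<Sum>k<m. DeltaT n T k (x i))) = 0"
    if "\<forall>i<n. Mz_adj n m i f = j (x i)" for x
  proof -
    have "ip f (j y) = cinner (C (f (\<lambda>_. 0)) + (\<Sum>i<n. T i (\<Sum>k<m. DeltaT n T k (x i)))) y" for y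
      using that by (intro hm_inner_j_eq f) auto
    then show ?thesis
      using cinner_left_eqI[of "C (f (\<lambda>_. 0)) + (\<Sum>i<n. T i (\<Sum>k<m. DeltaT n T k (x i)))" 0] by auto
  qed
  show ?thesis unfolding WM_iff[OF f] star ex ex_simps(2)[symmetric]
    by (intro iff_exI) (use eqv in auto)
qed

lemma representation_coefficients:
  assumes f0: "f0 \<in> \<D>" and y: "y \<in> Mz_star n m \<D> ` \<H>"
    and f: "f = (\<lambda>\<alpha>. const_fn f0 \<alpha> + Mz_row n (gram_inv n m \<D> y) \<alpha>)"
  shows "f (\<lambda>_. 0) = f0" "Mz_star n m \<D> f = y"
proof -
  obtain g where g: "g \<in> \<H>" "y = Mz_star n m \<D> g" using y by blast
  have f': "f = (\<lambda>\<alpha>. const_fn f0 \<alpha> + (g \<alpha> - const_fn (g (\<lambda>_. 0)) \<alpha>))"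
    unfolding f g(2) Mz_row_gram_inv[OF g(1)] ..
  then show "f (\<lambda>_. 0) = f0" by simp
  have "f \<in> \<H>" unfolding f' by (intro Hm_add Hm_diff Hm_const f0 g HmD(2)[OF g(1)])
  then show "Mz_star n m \<D> f = y" unfolding g(2) Mz_star_eq_iff[OF \<open>f \<in> \<H>\<close> g(1)] by (simp add: f')
qed

end

theorem theorem3:
  fixes n m :: nat and T :: "nat \<Rightarrow> 'h::complex_hilbert \<Rightarrow> 'h"
    and f :: "(nat \<Rightarrow> nat) \<Rightarrow> 'h"
  assumes "1 \<le> n" and "1 \<le> m"
    and "commuting_tuple n T"
    and "m_hypercontraction n m T"
    and "pure_tuple n T"
    and "f \<in> Hm n m (defectD n m T)"
  shows
   "(f \<in> WM n m T \<longleftrightarrow>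
      (\<exists>f0 x. f0 \<in> defectD n m T \<and>
         (\<lambda>i. if i < n then jmap n m T (x i) else (\<lambda>_. 0))
            \<in> Mz_star n m (defectD n m T) ` Hm n m (defectD n m T) \<and>
         defectC n m T f0 +
           (\<Sum>i<n. T i (\<Sum>k<m. ((-1) ^ k * of_nat (m choose (k + 1))) *\<^sub>R
              (\<Sum>\<alpha>\<in>{\<alpha>\<in>mindex n. mabs n \<alpha> = k}.
                  gammaM n \<alpha> *\<^sub>R Tpow n T \<alpha> (adjH (Tpow n T \<alpha>) (x i))))) = 0 \<and>
         f = (\<lambda>\<alpha>. const_fn f0 \<alpha> + Mz_row n (gram_inv n m (defectD n m T)
                (\<lambda>i. if i < n then jmap n m T (x i) else (\<lambda>_. 0))) \<alpha>))) \<and>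
    (\<forall>f0 x. f0 \<in> defectD n m T \<and>
         (\<lambda>i. if i < n then jmap n m T (x i) else (\<lambda>_. 0))
            \<in> Mz_star n m (defectD n m T) ` Hm n m (defectD n m T) \<and>
         defectC n m T f0 +
           (\<Sum>i<n. T i (\<Sum>k<m. ((-1) ^ k * of_nat (m choose (k + 1))) *\<^sub>R
              (\<Sum>\<alpha>\<in>{\<alpha>\<in>mindex n. mabs n \<alpha> = k}.
                  gammaM n \<alpha> *\<^sub>R Tpow n T \<alpha> (adjH (Tpow n T \<alpha>) (x i))))) = 0 \<and>
         f = (\<lambda>\<alpha>. const_fn f0 \<alpha> + Mz_row n (gram_inv n m (defectD n m T)
                (\<lambda>i. if i < n then jmap n m T (x i) else (\<lambda>_. 0))) \<alpha>)
       \<longrightarrow> (\<lambda>i. if i < n then jmap n m T (x i) else (\<lambda>_. 0)) = Mz_star n m (defectD n m T) f)"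
proof -
  interpret pure_hypercontraction n T m
    using assms(2-5) by unfold_locales (auto simp: m_hypercontraction_def)
  note f = assms(6)
  define Y where "Y x = (\<lambda>i. if i < n then j (x i) else (\<lambda>_. 0))" for x
  have rep: "f = (\<lambda>\<alpha>. const_fn (f (\<lambda>_. 0)) \<alpha> + Mz_row n (gram_inv n m \<D> (Mz_star n m \<D> f)) \<alpha>)"
    unfolding Mz_row_gram_inv[OF f] by simp
  have iff: "f \<in> WM n m T \<longleftrightarrow> (\<exists>x. Mz_star n m \<D> f = Y x \<and>
      C (f (\<lambda>_. 0)) + (\<Sum>i<n. T i (\<Sum>k<m. DeltaT n T k (x i))) = 0)"
    unfolding Y_def by (rule WM_representation_iff[OF f])
  have coeff: "f (\<lambda>_. 0) = f0 \<and> Mz_star n m \<D> f = Y x"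
    if "f0 \<in> \<D>" "Y x \<in> Mz_star n m \<D> ` \<H>"
      "f = (\<lambda>\<alpha>. const_fn f0 \<alpha> + Mz_row n (gram_inv n m \<D> (Y x)) \<alpha>)" for f0 x
    using representation_coefficients[OF that] by blast
  have "f \<in> WM n m T \<longleftrightarrow> (\<exists>f0 x. f0 \<in> \<D> \<and> Y x \<in> Mz_star n m \<D> ` \<H> \<and>
      C f0 + (\<Sum>i<n. T i (\<Sum>k<m. DeltaT n T k (x i))) = 0 \<and>
      f = (\<lambda>\<alpha>. const_fn f0 \<alpha> + Mz_row n (gram_inv n m \<D> (Y x)) \<alpha>))"
  proof
    assume "f \<in> WM n m T"
    then obtain x where x: "Mz_star n m \<D> f = Y x"
      "C (f (\<lambda>_. 0)) + (\<Sum>i<n. T i (\<Sum>k<m. DeltaT n T k (x i))) = 0"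
      unfolding iff by blast
    have "f (\<lambda>_. 0) \<in> \<D>" by (rule HmD(2)[OF f])
    moreover have "Y x \<in> Mz_star n m \<D> ` \<H>" using x(1) f by (metis imageI)
    ultimately show "\<exists>f0 x. f0 \<in> \<D> \<and> Y x \<in> Mz_star n m \<D> ` \<H> \<and>
        C f0 + (\<Sum>i<n. T i (\<Sum>k<m. DeltaT n T k (x i))) = 0 \<and>
        f = (\<lambda>\<alpha>. const_fn f0 \<alpha> + Mz_row n (gram_inv n m \<D> (Y x)) \<alpha>)"
      using x(2) rep[unfolded x(1)] by blast
  next
    assume "\<exists>f0 x. f0 \<in> \<D> \<and> Y x \<in> Mz_star n m \<D> ` \<H> \<and>
        C f0 + (\<Sum>i<n. T i (\<Sum>k<m. DeltaT n T k (x i))) = 0 \<and>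
        f = (\<lambda>\<alpha>. const_fn f0 \<alpha> + Mz_row n (gram_inv n m \<D> (Y x)) \<alpha>)"
    then obtain f0 x where *: "f0 \<in> \<D>" "Y x \<in> Mz_star n m \<D> ` \<H>"
        "f = (\<lambda>\<alpha>. const_fn f0 \<alpha> + Mz_row n (gram_inv n m \<D> (Y x)) \<alpha>)"
      and eq: "C f0 + (\<Sum>i<n. T i (\<Sum>k<m. DeltaT n T k (x i))) = 0"
      by (elim exE conjE)
    show "f \<in> WM n m T" unfolding iff using coeff[OF *] eq by (intro exI[of _ x]) simp
  qed
  then show ?thesis
    unfolding sum_DeltaT[symmetric] Y_def[symmetric]
    by (intro conjI allI impI) (assumption, elim conjE, rule sym, rule conjunct2, rule coeff)
qed

end
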